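(* Let $v_n$ be the maximum expected length of an increasing subsequence that can be selected by an online (non-anticipating) policy from $n$ independent random variables $X_1,\dots,X_n$ uniformly distributed on $[0,1]$. Then $$v_n=\sqrt{2n}-\frac{1}{12}\log n+O(1)\qquad\text{as } n\to\infty,$$ i.e. $\sup_{n\ge 1}\left|v_n-\sqrt{2n}+\frac{1}{12}\log n\right|<\infty$.
   Context: Online selection problem with fixed sample size $n$: items $X_1,\dots,X_n$, i.i.d. uniform on $[0,1]$, are observed one at a time. At time $i$, upon observing $X_i$, the decision maker must irrevocably accept or reject $X_i$, using only the information in $X_1,\dots,X_i$; the accepted items must form an increasing sequence. Formally, a policy is a sequence of stopping times $\tau_1<\tau_2<\cdots$ (with value $\infty$ if no further selection is made) with respect to the filtration generated by $X_1,X_2,\dots,X_n$, such that $X_{\tau_1}<X_{\tau_2}<\cdots$ along the finite stopping times. The length of the selected subsequence is $\max\{j:\tau_j\le n\}$ (and $0$ if no item is selected), and $v_n$ is the maximum of its expectation over all policies. For $z\in[0,1]$ let $v_k(z)$ be the maximum expected length in the problem with $k$ items when only items bigger than $z$ may be selected, so that $v_n=v_n(0)$. It is known that these functions are determined by the dynamic programming recursion $$v_k(z)=z\,v_{k-1}(z)+\int_z^1\max\{v_{k-1}(x)+1,\;v_{k-1}(z)\}\,\mathrm{d}x,\qquad k\ge 1,\qquad v_0(z)=0.$$ *)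

theory Defs
  imports "HOL-Probability.Probability"
begin

text \<open>
  The items are \<open>X 1, \<dots>, X n\<close>.  Times are extended natural numbers, the value \<open>\<infinity>\<close> of a
  stopping time meaning that the corresponding selection is never made.
\<close>

definition item_filtration ::
    "'a measure \<Rightarrow> (nat \<Rightarrow> 'a \<Rightarrow> real) \<Rightarrow> nat \<Rightarrow> enat \<Rightarrow> 'a measure" where
  "item_filtration M X n t =
     sigma (space M) {X i -` B \<inter> space M | i B. i \<in> {1..n} \<and> enat i \<le> t \<and> B \<in> sets borel}"

text \<open>
  The stopping times are \<open>\<tau> 1, \<tau> 2, \<dots>\<close>; the value of \<open>\<tau> 0\<close> is irrelevant.
  Strict monotonicity is required as long as the times are finite; once a time is \<open>\<infinity>\<close>,
  so are all later ones.
\<close>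

definition selection_policy ::
    "'a measure \<Rightarrow> (nat \<Rightarrow> 'a \<Rightarrow> real) \<Rightarrow> nat \<Rightarrow> (nat \<Rightarrow> 'a \<Rightarrow> enat) \<Rightarrow> bool" where
  "selection_policy M X n \<tau> \<longleftrightarrow>
     (\<forall>j\<ge>1. stopping_time (item_filtration M X n) (\<tau> j)) \<and>
     (\<forall>j\<ge>1. \<forall>\<omega>\<in>space M. \<tau> j \<omega> \<in> enat ` {1..n} \<union> {\<infinity>}) \<and>
     (\<forall>j\<ge>1. \<forall>\<omega>\<in>space M. \<tau> j \<omega> < \<tau> (Suc j) \<omega> \<or> (\<tau> j \<omega> = \<infinity> \<and> \<tau> (Suc j) \<omega> = \<infinity>)) \<and>
     (\<forall>j\<ge>1. \<forall>\<omega>\<in>space M. \<tau> (Suc j) \<omega> \<noteq> \<infinity> \<longrightarrow>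
        X (the_enat (\<tau> j \<omega>)) \<omega> < X (the_enat (\<tau> (Suc j) \<omega>)) \<omega>)"

definition selected_length :: "nat \<Rightarrow> (nat \<Rightarrow> 'a \<Rightarrow> enat) \<Rightarrow> 'a \<Rightarrow> nat" where
  "selected_length n \<tau> \<omega> = Max (insert 0 {j. 1 \<le> j \<and> \<tau> j \<omega> \<le> enat n})"

definition max_expected_length :: "'a measure \<Rightarrow> (nat \<Rightarrow> 'a \<Rightarrow> real) \<Rightarrow> nat \<Rightarrow> real" where
  "max_expected_length M X n =
     (SUP \<tau>\<in>{\<tau>. selection_policy M X n \<tau>}. \<integral>\<omega>. real (selected_length n \<tau> \<omega>) \<partial>M)"

definition iid_uniform_items :: "'a measure \<Rightarrow> (nat \<Rightarrow> 'a \<Rightarrow> real) \<Rightarrow> nat \<Rightarrow> bool" where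
  "iid_uniform_items M X n \<longleftrightarrow>
     prob_space M \<and>
     prob_space.indep_vars M (\<lambda>_. borel) X {1..n} \<and>
     (\<forall>i\<in>{1..n}. distr M borel (X i) = uniform_measure lborel {0..1})"

end

theory Submission
  imports Defs "HOL-Real_Asymp.Real_Asymp"
begin

text \<open>
  Let \<open>L\<^sub>i\<close> be the number of items selected up to time \<open>i\<close> and \<open>Z\<^sub>i\<close> the last selected value.  For every
  policy the expectation of \<open>L\<^sub>i + v\<^bsub>n-i\<^esub>(Z\<^sub>i)\<close> is nonincreasing in \<open>i\<close>, and for the greedy policy of the
  dynamic programming recursion it is constant; hence the optimal value is \<open>v\<^sub>n(0)\<close>.

  The Bellman operator is monotone and commutes with adding constants, so \<open>v\<^sub>k(z)\<close> can be compared with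
  functions of \<open>r = sqrt (2 k (1 - z))\<close> that are super- and subsolutions for large \<open>r\<close>.  For \<open>\<psi>(r) = r + h(r)\<close>
  the recursion reads, to leading order, \<open>r h'(r) / 2 = - 1/6 - r h'(r) / 2\<close>, so \<open>h = - ln r / 6\<close>, which is
  where \<open>- ln n / 12\<close> comes from.  The remaining errors in \<open>h'\<close> are of order \<open>r\<^sup>-\<^sup>2\<close>, for
  discretisation in \<open>k\<close> as well, and a correction \<open>\<mp> 1/r\<close> to \<open>\<psi>\<close> absorbs them.
\<close>

section \<open>The dynamic programming recursion\<close>

abbreviation unif01 :: "real measure" where
  "unif01 \<equiv> uniform_measure lborel {0..1}"

interpretation unif01: prob_space unif01
  by (rule prob_space_uniform_measure) auto

lemma integral_unif01:
  fixes f :: "real \<Rightarrow> real"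
  assumes [measurable]: "f \<in> borel_measurable borel"
  shows "integral\<^sup>L unif01 f = (\<integral>x. f x * indicator {0..1} x \<partial>lborel)"
proof -
  have "unif01 = density lborel (\<lambda>x. ennreal (indicator {0..1} x))"
    unfolding uniform_measure_def
    by (intro arg_cong2[of _ _ _ _ density] refl ext) (auto split: split_indicator)
  then show ?thesis
    by (simp add: integral_density mult.commute)
qed

text \<open>The value 0 stands for "nothing selected yet", and the first selected item has to exceed
  it strictly; hence the half-open interval.\<close>

lemma AE_unif01: "AE x in unif01. 0 < x \<and> x \<le> 1"
proof -
  have "AE x in lborel. x \<noteq> (0::real)"
    by (rule AE_lborel_singleton)
  then have "AE x in lborel. x \<in> {0..1} \<longrightarrow> 0 < x \<and> x \<le> (1::real)"
    by eventually_elim auto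
  then show ?thesis
    by (intro AE_uniform_measureI) auto
qed

text \<open>For \<open>z\<close> in [0,1] the case \<open>x \<le> z\<close> integrates to the
  summand z f(z), so \<open>bellman\<close> is the whole right-hand side of the recursion written as
  one integral over the next item.\<close>

definition choice_value :: "(real \<Rightarrow> real) \<Rightarrow> real \<Rightarrow> real \<Rightarrow> real" where
  "choice_value f z x = (if z < x then max (f x + 1) (f z) else f z)"

definition bellman :: "(real \<Rightarrow> real) \<Rightarrow> real \<Rightarrow> real" where
  "bellman f z = (\<integral>x. choice_value f z x \<partial>unif01)"

primrec opt_value :: "nat \<Rightarrow> real \<Rightarrow> real" where
  "opt_value 0 = (\<lambda>z. 0)"
| "opt_value (Suc k) = bellman (opt_value k)"

lemma measurable_choice_value [measurable]:
  assumes [measurable]: "f \<in> borel_measurable borel"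
    and [measurable]: "g \<in> borel_measurable M" "h \<in> borel_measurable M"
  shows "(\<lambda>w. choice_value f (g w) (h w)) \<in> borel_measurable M"
  unfolding choice_value_def by measurable

lemma abs_choice_value_le:
  assumes "\<And>x. \<bar>f x\<bar> \<le> B"
  shows "\<bar>choice_value f z x\<bar> \<le> B + 1"
  using assms[of x] assms[of z] by (auto simp: choice_value_def)

lemma integrable_choice_value:
  assumes [measurable]: "f \<in> borel_measurable borel" and "\<And>x. \<bar>f x\<bar> \<le> B"
  shows "integrable unif01 (choice_value f z)"
  by (rule unif01.integrable_const_bound[where B = "B + 1"])
    (use abs_choice_value_le[of f B] assms(2) in \<open>auto intro!: measurable_choice_value\<close>)

lemma measurable_opt_value [measurable]: "opt_value k \<in> borel_measurable borel"
proof (induction k)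
  case (Suc k)
  note [measurable] = Suc
  have "(\<lambda>z. \<integral>x. choice_value (opt_value k) z x \<partial>unif01) \<in> borel_measurable borel"
    by (rule unif01.borel_measurable_lebesgue_integral) (simp add: split_beta')
  then show ?case by (simp add: bellman_def[abs_def])
qed simp

text \<open>Stated for every real \<open>z\<close>, because the integrability arguments below rest
  on bounds over the whole line.\<close>

lemma opt_value_bounds: "0 \<le> opt_value k z \<and> opt_value k z \<le> real k"
proof (induction k arbitrary: z)
  case (Suc k)
  have b: "0 \<le> choice_value (opt_value k) z x \<and> choice_value (opt_value k) z x \<le> 1 + real k" for x
    using Suc[of x] Suc[of z] by (auto simp: choice_value_def)
  have i: "integrable unif01 (choice_value (opt_value k) z)"
    by (rule integrable_choice_value[where B = k]) (use Suc in auto)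
  show ?case
    unfolding opt_value.simps bellman_def
    using unif01.integral_le_const[OF i, of "real (Suc k)"] unif01.integral_ge_const[OF i, of 0] b
    by auto
qed simp

lemma abs_opt_value_le: "\<bar>opt_value k z\<bar> \<le> real k"
  using opt_value_bounds[of k z] by simp

text \<open>Comparison principle: \<open>choice_value f z x\<close> is increasing in the two numbers
  \<open>f x\<close> and \<open>f z\<close>. An order on [0,1] suffices, so comparison functions may
  be truncated outside; the global bounds give integrability.\<close>

lemma bellman_mono:
  assumes [measurable]: "f \<in> borel_measurable borel" "g \<in> borel_measurable borel"
    and "\<And>x. \<bar>f x\<bar> \<le> B" "\<And>x. \<bar>g x\<bar> \<le> C"
    and le: "\<And>x. x \<in> {0..1} \<Longrightarrow> f x \<le> g x" and z: "z \<in> {0..1}"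
  shows "bellman f z \<le> bellman g z"
  unfolding bellman_def
proof (rule integral_mono_AE)
  show "AE x in unif01. choice_value f z x \<le> choice_value g z x"
    using AE_unif01
  proof eventually_elim
    case (elim x)
    then show ?case using le[of x] le[of z] z by (auto simp: choice_value_def)
  qed
qed (use assms integrable_choice_value in blast)+

text \<open>k (1 - z) is the expected number of items above z. Being half the square of
  \<open>rad k z\<close>, it controls the value wherever \<open>rad\<close> is bounded.\<close>

lemma opt_value_le_linear:
  assumes "z \<in> {0..1}"
  shows "opt_value k z \<le> real k * (1 - z)"
  using assms
proof (induction k arbitrary: z)
  case (Suc k)
  have "opt_value (Suc k) z \<le> (\<integral>x. real k * (1 - z) + indicator {z..1} x \<partial>unif01)"
    unfolding opt_value.simps bellman_def
  proof (rule integral_mono_AE)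
    show "integrable unif01 (choice_value (opt_value k) z)"
      by (rule integrable_choice_value[where B = k]) (auto intro: abs_opt_value_le)
    show "AE x in unif01. choice_value (opt_value k) z x \<le> real k * (1 - z) + indicator {z..1} x"
      using AE_unif01
    proof eventually_elim
      case (elim x)
      have "real k * (1 - x) \<le> real k * (1 - z)" if "z < x"
        using that by (intro mult_left_mono) auto
      with elim Suc.IH[of x] Suc.IH[of z] Suc.prems show ?case
        by (auto simp: choice_value_def indicator_def)
    qed
  qed (rule Bochner_Integration.integrable_add, simp, auto intro!: unif01.integrable_const_bound[where B=1])
  also have "\<dots> = real k * (1 - z) + measure unif01 {z..1}"
    by (subst Bochner_Integration.integral_add)
      (auto intro!: unif01.integrable_const_bound[where B=1] simp: unif01.prob_space[simplified])
  also have "measure unif01 {z..1} = 1 - z"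
    using Suc.prems by simp
  finally show ?case by (simp add: algebra_simps)
qed simp

text \<open>Rejecting always secures \<open>f z\<close>, so an item contributes only the positive
  part of \<open>f x + 1 - f z\<close>; this gain is what gets compared with a linear one.\<close>

lemma bellman_eq_add_gain:
  assumes [measurable]: "f \<in> borel_measurable borel" and B: "\<And>x. \<bar>f x\<bar> \<le> B"
  shows "bellman f z = f z + (\<integral>x. (if z < x then max 0 (f x + 1 - f z) else 0) \<partial>unif01)"
    and "integrable unif01 (\<lambda>x. if z < x then max 0 (f x + 1 - f z) else 0)"
proof -
  have eq: "(\<lambda>x. if z < x then max 0 (f x + 1 - f z) else 0) = (\<lambda>x. choice_value f z x - f z)"
    by (auto simp: choice_value_def fun_eq_iff)
  show "integrable unif01 (\<lambda>x. if z < x then max 0 (f x + 1 - f z) else 0)"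
    unfolding eq by (intro Bochner_Integration.integrable_diff integrable_choice_value[OF assms]) auto
  show "bellman f z = f z + (\<integral>x. (if z < x then max 0 (f x + 1 - f z) else 0) \<partial>unif01)"
    unfolding eq bellman_def
    by (subst Bochner_Integration.integral_diff)
      (auto intro!: integrable_choice_value[OF assms] simp: unif01.prob_space[simplified])
qed

section \<open>One step of the recursion for a function of \<open>k (1 - z)\<close>\<close>

abbreviation rad :: "nat \<Rightarrow> real \<Rightarrow> real" where
  "rad k z \<equiv> sqrt (2 * real k * (1 - z))"

text \<open>
  A function of \<open>rad k\<close> with slope \<open>a\<close> gains from the next item on \<open>{z..z'}\<close>, where \<open>z'\<close> is the point at which
  it has dropped by 1 from its value at \<open>z\<close>.
\<close>

lemma integral_linear_gain:
  assumes k: "k \<ge> 1" and z: "z \<in> {0..1}" and a: "a > 0" and ra: "1 / a < rad k z"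
  defines "z' \<equiv> 1 - (rad k z - 1 / a)\<^sup>2 / (2 * real k)"
  shows "z \<le> z'" "z' < 1" "rad k z' = rad k z - 1 / a"
    and "integrable unif01 (\<lambda>x. (1 - a * (rad k z - rad k x)) * indicator {z..z'} x)"
    and "(\<integral>x. (1 - a * (rad k z - rad k x)) * indicator {z..z'} x \<partial>unif01)
           = (rad k z / (2 * a) - 1 / (6 * a\<^sup>2)) / real k"
proof -
  define r where "r = rad k z"
  have r2: "r\<^sup>2 = 2 * real k * (1 - z)"
    using z by (simp add: r_def)
  then have z_eq: "z = 1 - r\<^sup>2 / (2 * real k)"
    using k by (simp add: field_simps)
  have pos: "r - 1 / a > 0" "1 / a > 0"
    using ra a by (auto simp: r_def)
  have "(r - 1 / a)\<^sup>2 \<le> r\<^sup>2"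
    using pos by (intro power_mono) auto
  then show zz: "z \<le> z'"
    unfolding z'_def r_def[symmetric] using k by (subst z_eq) (simp add: divide_right_mono)
  show z1: "z' < 1"
    unfolding z'_def r_def[symmetric] using k pos by simp
  show rz': "rad k z' = rad k z - 1 / a"
    unfolding z'_def r_def[symmetric] using k pos by simp
  \<comment> \<open>An antiderivative of the integrand: \<open>rad k\<close> has derivative
    \<open>- k / rad k\<close>, so the cube contributes exactly \<open>a * rad k x\<close>.\<close>
  define F where "F x = (1 - a * r) * x - a / (3 * real k) * (rad k x) ^ 3" for x
  have D: "(F has_real_derivative (1 - a * (r - rad k x))) (at x)" if "z \<le> x" "x \<le> z'" for x
  proof -
    have x1: "2 * real k * (1 - x) > 0"
      using that z1 k by simp
    have s: "(rad k has_real_derivative - real k / rad k x) (at x)"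
      using x1 by (auto intro!: derivative_eq_intros simp: field_simps)
    have "(F has_real_derivative (1 - a * r) - a / (3 * real k) * (3 * (rad k x)\<^sup>2 * (- real k / rad k x))) (at x)"
      unfolding F_def
      using DERIV_diff[OF DERIV_cmult_Id[of "1 - a * r" x] DERIV_cmult[OF DERIV_power[OF s, of 3], of "a / (3 * real k)"]]
      by (simp add: eval_nat_numeral mult_ac)
    also have "(1 - a * r) - a / (3 * real k) * (3 * (rad k x)\<^sup>2 * (- real k / rad k x)) = (1 - a * r) + a * rad k x"
      using k x1 by (simp add: power2_eq_square del: real_sqrt_mult_self)
    also have "\<dots> = 1 - a * (r - rad k x)"
      by (simp add: algebra_simps)
    finally show ?thesis .
  qed
  have C: "isCont (\<lambda>x. 1 - a * (r - rad k x)) x" for x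
    by (intro continuous_intros)
  have *: "(1 - a * (rad k z - rad k x)) * indicator {z..z'} x * indicator {0..1} x
        = (1 - a * (r - rad k x)) * indicator {z..z'} x" for x
    using z z1 by (auto simp: r_def split: split_indicator)
  have "(\<integral>x. (1 - a * (rad k z - rad k x)) * indicator {z..z'} x \<partial>unif01) = F z' - F z"
    by (subst integral_unif01) (simp_all add: * integral_FTC_Icc_real[OF zz D C])
  also have "\<dots> = (r / (2 * a) - 1 / (6 * a\<^sup>2)) / real k"
  proof -
    have Fz: "F z = (1 - a * r) * (1 - r\<^sup>2 / (2 * real k)) - a / (3 * real k) * r ^ 3"
      unfolding F_def using z_eq r_def by simp
    have Fz': "F z' = (1 - a * r) * (1 - (r - 1 / a)\<^sup>2 / (2 * real k)) - a / (3 * real k) * (r - 1 / a) ^ 3"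
      unfolding F_def rz' r_def[symmetric] by (simp add: z'_def r_def)
    \<comment> \<open>With \<open>a * b = 1\<close> the remaining cancellation is a polynomial
      identity.\<close>
    define b where "b = 1 / a"
    have ab: "a * b = 1"
      using a by (simp add: b_def)
    have "F z' - F z = ((1 - a * r) * (r\<^sup>2 - (r - b)\<^sup>2) / 2 + a / 3 * (r ^ 3 - (r - b) ^ 3)) / real k"
      unfolding Fz Fz' b_def[symmetric] by (simp add: diff_divide_distrib add_divide_distrib algebra_simps)
    also have "1 - a * r = - a * (r - b)"
      using ab by (simp add: algebra_simps)
    also have "- a * (r - b) * (r\<^sup>2 - (r - b)\<^sup>2) / 2 + a / 3 * (r ^ 3 - (r - b) ^ 3)
        = (a * b) * (r * b / 2 - b\<^sup>2 / 6)"
      by (simp add: field_simps power2_eq_square power3_eq_cube)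
    also have "\<dots> = r / (2 * a) - 1 / (6 * a\<^sup>2)"
      unfolding ab by (simp add: b_def power_divide)
    finally show ?thesis .
  qed
  finally show "(\<integral>x. (1 - a * (rad k z - rad k x)) * indicator {z..z'} x \<partial>unif01)
           = (rad k z / (2 * a) - 1 / (6 * a\<^sup>2)) / real k"
    by (simp add: r_def)
  show "integrable unif01 (\<lambda>x. (1 - a * (rad k z - rad k x)) * indicator {z..z'} x)"
  proof (rule unif01.integrable_const_bound[where B = 1])
    have "\<bar>1 - a * (rad k z - rad k x)\<bar> \<le> 1" if "z \<le> x" "x \<le> z'" for x
    proof -
      have "rad k x \<le> rad k z" "rad k z' \<le> rad k x"
        using that by (auto intro!: mult_left_mono)
      then have "0 \<le> a * (rad k z - rad k x)" "a * (rad k z - rad k x) \<le> a * (1 / a)"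
        using a rz' by (auto intro!: mult_left_mono mult_nonneg_nonneg simp del: times_divide_eq_right)
      then show ?thesis using a by simp
    qed
    then show "AE x in unif01. norm ((1 - a * (rad k z - rad k x)) * indicator {z..z'} x) \<le> 1"
      by (auto split: split_indicator)
  qed auto
qed

text \<open>The linear gain is nonnegative up to z' and nonpositive beyond it, so its positive part
  is the integrand of \<open>integral_linear_gain\<close>.\<close>

lemma bellman_le:
  assumes [measurable]: "f \<in> borel_measurable borel" and B: "\<And>x. \<bar>f x\<bar> \<le> B"
    and k: "k \<ge> 1" and z: "z \<in> {0..1}" and a: "a > 0" and ra: "1 / a < rad k z"
    and f: "\<And>x. z < x \<Longrightarrow> x \<le> 1 \<Longrightarrow> f x + 1 - f z \<le> max 0 (1 - a * (rad k z - rad k x))"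
  shows "bellman f z \<le> f z + (rad k z / (2 * a) - 1 / (6 * a\<^sup>2)) / real k"
proof -
  define z' where "z' = 1 - (rad k z - 1 / a)\<^sup>2 / (2 * real k)"
  note I = integral_linear_gain[OF k z a ra, folded z'_def]
  have "(\<integral>x. (if z < x then max 0 (f x + 1 - f z) else 0) \<partial>unif01)
      \<le> (\<integral>x. (1 - a * (rad k z - rad k x)) * indicator {z..z'} x \<partial>unif01)"
  proof (rule integral_mono_AE[OF bellman_eq_add_gain(2)[OF assms(1,2)] I(4)])
    show "AE x in unif01. (if z < x then max 0 (f x + 1 - f z) else 0)
        \<le> (1 - a * (rad k z - rad k x)) * indicator {z..z'} x"
      using AE_unif01
    proof eventually_elim
      case (elim x)
      have le: "1 - a * (rad k z - rad k x) \<le> 0" if "z' \<le> x"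
      proof -
        have "rad k x \<le> rad k z'"
          using that by (auto intro!: mult_left_mono)
        then have "a * (1 / a) \<le> a * (rad k z - rad k x)"
          using I(3) a by (intro mult_left_mono) auto
        then show ?thesis using a by simp
      qed
      have ge: "1 - a * (rad k z - rad k x) \<ge> 0" if "x \<le> z'"
      proof -
        have "rad k x \<ge> rad k z'"
          using that by (auto intro!: mult_left_mono)
        then have "a * (1 / a) \<ge> a * (rad k z - rad k x)"
          using I(3) a by (intro mult_left_mono) auto
        then show ?thesis using a by simp
      qed
      show ?case using f[of x] le ge elim
        by (cases "x \<le> z'") (auto simp: indicator_def)
    qed
  qed
  then show ?thesis
    using bellman_eq_add_gain(1)[OF assms(1,2), of z] I(5) by simp
qed

text \<open>The condition on \<open>rad k x\<close> covers every \<open>x\<close> up to z'; beyond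
  z' the true gain is nonnegative and the truncated linear gain is 0.\<close>

lemma bellman_ge:
  assumes [measurable]: "f \<in> borel_measurable borel" and B: "\<And>x. \<bar>f x\<bar> \<le> B"
    and k: "k \<ge> 1" and z: "z \<in> {0..1}" and a: "a > 0" and ra: "1 / a < rad k z"
    and f: "\<And>x. z < x \<Longrightarrow> x \<le> 1 \<Longrightarrow> rad k z - 1 / a \<le> rad k x \<Longrightarrow>
              f x + 1 - f z \<ge> 1 - a * (rad k z - rad k x)"
  shows "bellman f z \<ge> f z + (rad k z / (2 * a) - 1 / (6 * a\<^sup>2)) / real k"
proof -
  define z' where "z' = 1 - (rad k z - 1 / a)\<^sup>2 / (2 * real k)"
  note I = integral_linear_gain[OF k z a ra, folded z'_def]
  have "(\<integral>x. (if z < x then max 0 (f x + 1 - f z) else 0) \<partial>unif01)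
      \<ge> (\<integral>x. (1 - a * (rad k z - rad k x)) * indicator {z..z'} x \<partial>unif01)"
  proof (rule integral_mono_AE[OF I(4) bellman_eq_add_gain(2)[OF assms(1,2)]])
    \<comment> \<open>At \<open>x = z\<close> the linear gain is 1 while the gain in
      \<open>bellman\<close> is 0 there; this null set is discarded.\<close>
    have "AE x in lborel. x \<noteq> z"
      by (rule AE_lborel_singleton)
    then have "AE x in unif01. x \<noteq> z"
      by (intro AE_uniform_measureI) (auto elim: eventually_mono)
    then show "AE x in unif01. (1 - a * (rad k z - rad k x)) * indicator {z..z'} x
        \<le> (if z < x then max 0 (f x + 1 - f z) else 0)"
      using AE_unif01
    proof eventually_elim
      case (elim x)
      have "rad k x \<ge> rad k z'" if "x \<le> z'"
        using that by (auto intro!: mult_left_mono)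
      then show ?case using f[of x] elim I(3)
        by (auto simp: indicator_def max_def split: if_splits)
    qed
  qed
  then show ?thesis
    using bellman_eq_add_gain(1)[OF assms(1,2), of z] I(5) by simp
qed

section \<open>Upper and lower solutions\<close>

lemma rad_power2: "z \<in> {0..1} \<Longrightarrow> (rad k z)\<^sup>2 = 2 * real k * (1 - z)"
  by simp

text \<open>The squares of the two radii differ by 2 (1 - z), which is at most 2. The last two
  identities write the growth of \<open>rad\<close> and the factor 1/k as multiples of 2 (1 - z), so
  that comparing growth with gain becomes an inequality in r alone.\<close>

lemma rad_Suc:
  assumes z: "z \<in> {0..1}" and r: "rad k z > 0"
  shows "rad k z \<le> rad (Suc k) z" "rad (Suc k) z \<le> rad k z + 1 / rad k z"
    and "rad (Suc k) z - rad k z = 2 * (1 - z) / (rad (Suc k) z + rad k z)"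
    and "1 / real k = 2 * (1 - z) / (rad k z)\<^sup>2"
proof -
  show le: "rad k z \<le> rad (Suc k) z"
    using z by (intro real_sqrt_le_mono mult_right_mono) auto
  have sq: "(rad (Suc k) z)\<^sup>2 = (rad k z)\<^sup>2 + 2 * (1 - z)"
    unfolding rad_power2[OF z] by (simp add: algebra_simps)
  then show "rad (Suc k) z - rad k z = 2 * (1 - z) / (rad (Suc k) z + rad k z)"
    using add_pos_pos[OF order_less_le_trans[OF r le] r]
    by (simp only: eq_divide_eq power2_eq_square) (simp add: ring_distribs)
  have "(rad (Suc k) z)\<^sup>2 \<le> (rad k z + 1 / rad k z)\<^sup>2"
  proof -
    have "(x + 1 / x)\<^sup>2 = x\<^sup>2 + 2 + (1 / x)\<^sup>2" if "x > 0" for x :: real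
      using that by (simp add: power2_sum)
    moreover have "0 \<le> z" using z by simp
    ultimately show ?thesis
      unfolding sq using r zero_le_power2[of "1 / rad k z"] by (smt (verit))
  qed
  then show "rad (Suc k) z \<le> rad k z + 1 / rad k z"
    by (rule power2_le_imp_le) (use r in auto)
  have "(rad k z)\<^sup>2 = 2 * real k * (1 - z)"
    using z by simp
  moreover have "k \<noteq> 0" "z \<noteq> 1"
    using r by (auto intro: ccontr)
  ultimately show "1 / real k = 2 * (1 - z) / (rad k z)\<^sup>2"
    by (simp only:) (simp add: field_simps)
qed

text \<open>The square drops by at most 2 when k is lowered by one. In the induction on k this puts
  the previous radius in the range of the step lemmas.\<close>

lemma rad_ge_of_rad_Suc:
  assumes "z \<in> {0..1}" "rad (Suc k) z > R" "R \<ge> 2"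
  shows "rad k z \<ge> R - 1"
proof -
  have "(R - 1)\<^sup>2 \<le> R\<^sup>2 - 2"
    using assms(3) by (simp add: power2_eq_square algebra_simps)
  also have "\<dots> \<le> (rad (Suc k) z)\<^sup>2 - 2"
    using assms by (intro diff_right_mono power_mono) auto
  also have "\<dots> \<le> (rad k z)\<^sup>2"
    unfolding rad_power2[OF assms(1)] using assms(1) by (simp add: algebra_simps)
  finally show ?thesis
    by (rule power2_le_imp_le) (use assms in auto)
qed

lemma rad_antimono: "x \<le> y \<Longrightarrow> rad k y \<le> rad k x"
  by (intro real_sqrt_le_mono mult_left_mono) auto

lemma rad_le: "x \<in> {0..1} \<Longrightarrow> rad k x \<le> rad k 0"
  by (rule rad_antimono) auto

text \<open>What matters is the slope, not the size: - 1/r adds 1/r^2 to the derivative, which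
  raises the growth in k and, to leading order, lowers the gain from the next item. The opposite
  sign therefore gives the lower solution.\<close>

definition upper_sol :: "real \<Rightarrow> real" where
  "upper_sol r = r - ln r / 6 - 1 / r"

definition lower_sol :: "real \<Rightarrow> real" where
  "lower_sol r = r - ln r / 6 + 1 / r"

lemma DERIV_upper_sol:
  "r > 0 \<Longrightarrow> (upper_sol has_real_derivative 1 - 1 / (6 * r) + 1 / r\<^sup>2) (at r)"
  unfolding upper_sol_def[abs_def]
  by (auto intro!: derivative_eq_intros simp: power2_eq_square field_simps)

lemma DERIV_lower_sol:
  "r > 0 \<Longrightarrow> (lower_sol has_real_derivative 1 - 1 / (6 * r) - 1 / r\<^sup>2) (at r)"
  unfolding lower_sol_def[abs_def]
  by (auto intro!: derivative_eq_intros simp: power2_eq_square field_simps)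

text \<open>The two nonconstant terms of the derivative are monotone in opposite directions, so
  after the mean value theorem each is estimated at its own endpoint.\<close>

lemma upper_sol_increment_ge:
  assumes "0 < s" "s \<le> r"
  shows "upper_sol r - upper_sol s \<ge> (1 - 1 / (6 * s) + 1 / r\<^sup>2) * (r - s)"
proof (cases "s = r")
  case False
  have "\<exists>x>s. x < r \<and> upper_sol r - upper_sol s = (r - s) * (1 - 1 / (6 * x) + 1 / x\<^sup>2)"
    by (rule MVT2) (use assms False in \<open>auto intro!: DERIV_upper_sol\<close>)
  then obtain x where x: "s < x" "x < r"
    and eq: "upper_sol r - upper_sol s = (r - s) * (1 - 1 / (6 * x) + 1 / x\<^sup>2)"
    by blast
  have "1 / (6 * x) \<le> 1 / (6 * s)" "1 / r\<^sup>2 \<le> 1 / x\<^sup>2"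
    using x assms by (auto intro!: divide_left_mono power_mono)
  then show ?thesis
    unfolding eq by (subst mult.commute, intro mult_left_mono) (use assms in auto)
qed simp

text \<open>Here both nonconstant terms of the derivative increase, so the slope at the right
  endpoint is the largest.\<close>

lemma lower_sol_increment_le:
  assumes "0 < s" "s \<le> r"
  shows "lower_sol r - lower_sol s \<le> (1 - 1 / (6 * r) - 1 / r\<^sup>2) * (r - s)"
proof (cases "s = r")
  case False
  have "\<exists>x>s. x < r \<and> lower_sol r - lower_sol s = (r - s) * (1 - 1 / (6 * x) - 1 / x\<^sup>2)"
    by (rule MVT2) (use assms False in \<open>auto intro!: DERIV_lower_sol\<close>)
  then obtain x where x: "s < x" "x < r"
    and eq: "lower_sol r - lower_sol s = (r - s) * (1 - 1 / (6 * x) - 1 / x\<^sup>2)"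
    by blast
  have "1 / (6 * r) \<le> 1 / (6 * x)" "1 / r\<^sup>2 \<le> 1 / x\<^sup>2"
    using x assms by (auto intro!: divide_left_mono power_mono)
  then show ?thesis
    unfolding eq by (subst mult.commute, intro mult_right_mono) (use assms in auto)
qed simp

lemma upper_sol_mono:
  assumes "1 \<le> s" "s \<le> r"
  shows "upper_sol s \<le> upper_sol r"
proof -
  have "0 \<le> 1 - 1 / (6 * s) + 1 / r\<^sup>2"
    using assms by (intro add_nonneg_nonneg) (auto simp: field_simps)
  then have "0 \<le> (1 - 1 / (6 * s) + 1 / r\<^sup>2) * (r - s)"
    using assms by (intro mult_nonneg_nonneg) auto
  then show ?thesis
    using upper_sol_increment_ge[of s r] assms by linarith
qed

lemma upper_sol_1 [simp]: "upper_sol 1 = 0"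
  by (simp add: upper_sol_def)

lemma upper_sol_nonneg: "1 \<le> r \<Longrightarrow> 0 \<le> upper_sol r"
  using upper_sol_mono[of 1 r] by simp

lemma abs_upper_sol_trunc_le:
  "\<bar>K + upper_sol (max 1 (min c s))\<bar> \<le> \<bar>K\<bar> + upper_sol (max 1 c)"
proof -
  have "0 \<le> upper_sol (max 1 (min c s))"
    "upper_sol (max 1 (min c s)) \<le> upper_sol (max 1 c)"
    by (auto intro!: upper_sol_mono upper_sol_nonneg)
  then show ?thesis by linarith
qed

lemma abs_lower_sol_trunc_le:
  "\<bar>lower_sol (max 2 (min c s)) - K\<bar> \<le> 2 * (2 + \<bar>c\<bar>) + 1 + \<bar>K\<bar>"
proof -
  define t where "t = max 2 (min c s)"
  have t: "2 \<le> t" "t \<le> 2 + \<bar>c\<bar>"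
    by (auto simp: t_def)
  have "0 \<le> ln t" "ln t \<le> t"
    using t by (auto intro: order_trans[OF ln_le_minus_one])
  moreover have "0 \<le> 1 / t" "1 / t \<le> 1"
    using t by auto
  ultimately have "\<bar>lower_sol t\<bar> \<le> 2 * t + 1"
    using t unfolding lower_sol_def by linarith
  also have "\<dots> \<le> 2 * (2 + \<bar>c\<bar>) + 1"
    using t by simp
  finally show ?thesis
    unfolding t_def[symmetric] by (intro order_trans[OF abs_triangle_ineq4] add_right_mono)
qed

text \<open>Left: the bound of \<open>bellman_le\<close> for the gain; right: a lower bound for the
  growth of \<open>upper_sol\<close>, using that the next radius is at most r + 1/r; both per factor
  2 (1 - z). Both expand as 1/(2r) - 1/(12 r^2) + c/r^3, with c = -3/8 on the left and c = 1/4 on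
  the right.\<close>

lemma upper_sol_bellman_asymp:
  "eventually (\<lambda>r::real. let a = 1 - 1 / (6 * (r - 2)) + 1 / r\<^sup>2 in
      (r / (2 * a) - 1 / (6 * a\<^sup>2)) / r\<^sup>2 \<le> (1 - 1 / (6 * r) + 1 / (r + 1 / r)\<^sup>2) / (2 * r + 1 / r)) at_top"
  unfolding Let_def by real_asymp

text \<open>Growth is now on the left and gain on the right; the expansions again agree up to r^-2,
  and the coefficients of r^-3 are -1/2 and 11/24.\<close>

lemma lower_sol_bellman_asymp:
  "eventually (\<lambda>r::real. let a = 1 - 1 / (6 * r) - 1 / r\<^sup>2 in
      (1 - 1 / (6 * (r + 1 / r)) - 1 / (r + 1 / r)\<^sup>2) / (2 * r) \<le> (r / (2 * a) - 1 / (6 * a\<^sup>2)) / r\<^sup>2) at_top"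
  unfolding Let_def by real_asymp

text \<open>
  The truncation \<open>min (rad k 0)\<close> is vacuous on \<open>{0..1}\<close>; it keeps the function bounded on the whole real line.
\<close>

lemma upper_sol_bellman_step:
  obtains R where "R \<ge> 4"
    and "\<And>k z K. z \<in> {0..1} \<Longrightarrow> rad k z \<ge> R \<Longrightarrow>
           bellman (\<lambda>x. K + upper_sol (max 1 (min (rad k 0) (rad k x)))) z \<le> K + upper_sol (rad (Suc k) z)"
proof -
  \<comment> \<open>A lower bound for the slope of \<open>upper_sol\<close> on [r - 2, r]. The width
    2 suffices: the slope will be at least 1/2, so the gain is exhausted within a drop of 2.\<close>
  define A where "A = (\<lambda>r::real. 1 - 1 / (6 * (r - 2)) + 1 / r\<^sup>2)"
  obtain R0 where R0: "\<And>r. r \<ge> R0 \<Longrightarrow>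
      (r / (2 * A r) - 1 / (6 * (A r)\<^sup>2)) / r\<^sup>2 \<le> (1 - 1 / (6 * r) + 1 / (r + 1 / r)\<^sup>2) / (2 * r + 1 / r)"
    using upper_sol_bellman_asymp unfolding eventually_at_top_linorder Let_def A_def by auto
  define R where "R = max 4 R0"
  have "bellman (\<lambda>x. K + upper_sol (max 1 (min (rad k 0) (rad k x)))) z \<le> K + upper_sol (rad (Suc k) z)"
    if z: "z \<in> {0..1}" and rR: "rad k z \<ge> R" for k z K
  proof -
    define r where "r = rad k z"
    define a where "a = A r"
    define f where "f x = K + upper_sol (max 1 (min (rad k 0) (rad k x)))" for x
    have "r \<ge> R" using rR by (simp add: r_def)
    then have r: "r \<ge> 4" "r \<ge> R0" "r > 0"
      by (auto simp: R_def)
    have k: "k \<ge> 1"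
      using r by (cases k) (auto simp: r_def)
    have "1 / (6 * (r - 2)) \<le> 1 / 12"
      using r by (simp add: field_simps)
    then have a: "a \<ge> 1 / 2"
      unfolding a_def A_def using r by (intro order_trans[OF _ add_increasing2]) auto
    then have "1 / a \<le> 2"
      by (simp add: field_simps)
    then have ra: "1 / a < r"
      using r by simp
    have f_eq: "f x = K + upper_sol (max 1 (rad k x))" if "x \<in> {0..1}" for x
      using rad_le[OF that, of k] by (simp add: f_def min_def)
    have meas: "f \<in> borel_measurable borel"
      unfolding f_def upper_sol_def by measurable
    have bound: "\<bar>f x\<bar> \<le> \<bar>K\<bar> + upper_sol (max 1 (rad k 0))" for x
      unfolding f_def by (rule abs_upper_sol_trunc_le)
    have gain: "f x + 1 - f z \<le> max 0 (1 - a * (rad k z - rad k x))" if x: "z < x" "x \<le> 1" for x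
    proof -
      have x01: "x \<in> {0..1}" using x z by auto
      have xz: "rad k x \<le> r"
        unfolding r_def using x by (intro rad_antimono) auto
      have fz: "f z = K + upper_sol r"
        using f_eq[OF z, folded r_def] r by (simp add: max_def)
      have slope: "a * (r - s) \<le> upper_sol r - upper_sol s" if s: "r - 2 \<le> s" "s \<le> r" for s
      proof -
        have "1 / (6 * s) \<le> 1 / (6 * (r - 2))"
          using s r by (intro divide_left_mono) auto
        then have "a * (r - s) \<le> (1 - 1 / (6 * s) + 1 / r\<^sup>2) * (r - s)"
          unfolding a_def A_def using s by (intro mult_right_mono) auto
        also have "\<dots> \<le> upper_sol r - upper_sol s"
          using upper_sol_increment_ge[of s r] s r by auto
        finally show ?thesis .
      qed
      show ?thesis
      proof (cases "rad k x \<ge> r - 2")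
        case True
        then show ?thesis
          using slope[OF True xz] r f_eq[OF x01] fz unfolding r_def[symmetric] by (simp add: max_absorb2)
      next
        \<comment> \<open>Over the drop from r to r - 2 the function loses at least 2a, hence at
          least 1: such an item brings no gain.\<close>
        case False
        have "upper_sol (max 1 (rad k x)) \<le> upper_sol (r - 2)"
          using False r by (intro upper_sol_mono) auto
        moreover have "1 \<le> upper_sol r - upper_sol (r - 2)"
          using slope[of "r - 2"] a by simp
        ultimately show ?thesis
          using f_eq[OF x01] fz by simp
      qed
    qed
    have "bellman f z \<le> f z + (r / (2 * a) - 1 / (6 * a\<^sup>2)) / real k"
      unfolding r_def
      by (rule bellman_le[OF meas bound k z _ _ gain]) (use a ra in \<open>auto simp: r_def\<close>)
    also have "\<dots> \<le> K + upper_sol (rad (Suc k) z)"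
    proof -
      define q where "q = rad (Suc k) z"
      note q = rad_Suc[OF z, of k, folded q_def r_def, OF r(3)]
      have u: "0 \<le> 2 * (1 - z)" using z by simp
      \<comment> \<open>Trading 1/k for 2 (1 - z) / r^2 leaves only r in the bracket, where the
        asymptotic inequality applies.\<close>
      have "(r / (2 * a) - 1 / (6 * a\<^sup>2)) / real k = 2 * (1 - z) * ((r / (2 * a) - 1 / (6 * a\<^sup>2)) / r\<^sup>2)"
        using arg_cong[OF q(4), of "\<lambda>c. (r / (2 * a) - 1 / (6 * a\<^sup>2)) * c"] by simp
      also have "\<dots> \<le> 2 * (1 - z) * ((1 - 1 / (6 * r) + 1 / (r + 1 / r)\<^sup>2) / (2 * r + 1 / r))"
        using R0[OF r(2)] u unfolding a_def by (rule mult_left_mono)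
      also have "\<dots> = (1 - 1 / (6 * r) + 1 / (r + 1 / r)\<^sup>2) * (2 * (1 - z) / (2 * r + 1 / r))"
        by simp
      also have "\<dots> \<le> (1 - 1 / (6 * r) + 1 / q\<^sup>2) * (2 * (1 - z) / (q + r))"
      proof (rule mult_mono)
        have "1 / (r + 1 / r)\<^sup>2 \<le> 1 / q\<^sup>2"
          using q r by (intro divide_left_mono power_mono) auto
        then show "1 - 1 / (6 * r) + 1 / (r + 1 / r)\<^sup>2 \<le> 1 - 1 / (6 * r) + 1 / q\<^sup>2"
          by simp
        show "2 * (1 - z) / (2 * r + 1 / r) \<le> 2 * (1 - z) / (q + r)"
          using q r u by (intro divide_left_mono) auto
        show "0 \<le> 1 - 1 / (6 * r) + 1 / q\<^sup>2"
          using r by (intro add_nonneg_nonneg) (auto simp: field_simps)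
        show "0 \<le> 2 * (1 - z) / (2 * r + 1 / r)"
          using r u by (intro divide_nonneg_nonneg) auto
      qed
      also have "\<dots> = (1 - 1 / (6 * r) + 1 / q\<^sup>2) * (q - r)"
        unfolding q(3) ..
      also have "\<dots> \<le> upper_sol q - upper_sol r"
        by (rule upper_sol_increment_ge) (use q r in auto)
      finally show ?thesis
        using f_eq[OF z, folded r_def] r unfolding q_def[symmetric] by (simp add: max_def)
    qed
    finally show ?thesis unfolding f_def .
  qed
  then show thesis
    by (intro that[of R]) (auto simp: R_def)
qed

lemma lower_sol_bellman_step:
  obtains R where "R \<ge> 4"
    and "\<And>k z K. z \<in> {0..1} \<Longrightarrow> rad k z \<ge> R \<Longrightarrow>
           bellman (\<lambda>x. lower_sol (max 2 (min (rad k 0) (rad k x))) - K) z \<ge> lower_sol (rad (Suc k) z) - K"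
proof -
  \<comment> \<open>The derivative of \<open>lower_sol\<close> at r itself, which by convexity
    dominates the slopes to the left of r.\<close>
  define A where "A = (\<lambda>r::real. 1 - 1 / (6 * r) - 1 / r\<^sup>2)"
  obtain R0 where R0: "\<And>r. r \<ge> R0 \<Longrightarrow>
      (1 - 1 / (6 * (r + 1 / r)) - 1 / (r + 1 / r)\<^sup>2) / (2 * r) \<le> (r / (2 * A r) - 1 / (6 * (A r)\<^sup>2)) / r\<^sup>2"
    using lower_sol_bellman_asymp unfolding eventually_at_top_linorder Let_def A_def by auto
  define R where "R = max 4 R0"
  have "bellman (\<lambda>x. lower_sol (max 2 (min (rad k 0) (rad k x))) - K) z \<ge> lower_sol (rad (Suc k) z) - K"
    if z: "z \<in> {0..1}" and rR: "rad k z \<ge> R" for k z K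
  proof -
    define r where "r = rad k z"
    define a where "a = A r"
    define f where "f x = lower_sol (max 2 (min (rad k 0) (rad k x))) - K" for x
    have "r \<ge> R" using rR by (simp add: r_def)
    then have r: "r \<ge> 4" "r \<ge> R0" "r > 0"
      by (auto simp: R_def)
    have k: "k \<ge> 1"
      using r by (cases k) (auto simp: r_def)
    have "1 / (6 * r) \<le> 1 / (6 * 4)" "1 / r\<^sup>2 \<le> 1 / 4\<^sup>2"
      using r by (intro divide_left_mono power_mono; simp)+
    then have a: "a \<ge> 1 / 2"
      unfolding a_def A_def by simp
    then have a2: "1 / a \<le> 2"
      by (simp add: field_simps)
    then have ra: "1 / a < r"
      using r by simp
    have f_eq: "f x = lower_sol (max 2 (rad k x)) - K" if "x \<in> {0..1}" for x
      using rad_le[OF that, of k] by (simp add: f_def min_def)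
    have meas: "f \<in> borel_measurable borel"
      unfolding f_def lower_sol_def by measurable
    have bound: "\<bar>f x\<bar> \<le> 2 * (2 + \<bar>rad k 0\<bar>) + 1 + \<bar>K\<bar>" for x
      unfolding f_def by (rule abs_lower_sol_trunc_le)
    have gain: "f x + 1 - f z \<ge> 1 - a * (rad k z - rad k x)"
      if x: "z < x" "x \<le> 1" "rad k z - 1 / a \<le> rad k x" for x
    proof -
      have x01: "x \<in> {0..1}" using x z by auto
      \<comment> \<open>Since 1/a is at most 2 and r at least 4, the relevant \<open>x\<close> keep
        \<open>rad k x\<close> at 2 or more, so the truncation \<open>max 2\<close> is
        inactive.\<close>
      have xz: "rad k x \<le> r" "rad k x \<ge> 2"
        using rad_antimono[of z x k] x a2 r unfolding r_def by linarith+
      show ?thesis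
        using lower_sol_increment_le[OF order_less_le_trans[OF zero_less_numeral xz(2)] xz(1)] xz r f_eq[OF x01] f_eq[OF z, folded r_def]
        unfolding r_def[symmetric] by (simp add: a_def A_def max_absorb2)
    qed
    have "lower_sol (rad (Suc k) z) - K \<le> f z + (r / (2 * a) - 1 / (6 * a\<^sup>2)) / real k"
    proof -
      define q where "q = rad (Suc k) z"
      note q = rad_Suc[OF z, of k, folded q_def r_def, OF r(3)]
      have u: "0 \<le> 2 * (1 - z)" using z by simp
      have "lower_sol q - lower_sol r \<le> (1 - 1 / (6 * q) - 1 / q\<^sup>2) * (q - r)"
        by (rule lower_sol_increment_le) (use q r in auto)
      also have "\<dots> = (1 - 1 / (6 * q) - 1 / q\<^sup>2) * (2 * (1 - z) / (q + r))"
        unfolding q(3) ..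
      also have "\<dots> \<le> (1 - 1 / (6 * (r + 1 / r)) - 1 / (r + 1 / r)\<^sup>2) * (2 * (1 - z) / (2 * r))"
      proof (rule mult_mono)
        have "1 / (r + 1 / r)\<^sup>2 \<le> 1 / q\<^sup>2" "1 / (6 * (r + 1 / r)) \<le> 1 / (6 * q)"
          using q r by (auto intro!: divide_left_mono power_mono)
        then show "1 - 1 / (6 * q) - 1 / q\<^sup>2 \<le> 1 - 1 / (6 * (r + 1 / r)) - 1 / (r + 1 / r)\<^sup>2"
          by simp
        show "2 * (1 - z) / (q + r) \<le> 2 * (1 - z) / (2 * r)"
          using q r u by (intro divide_left_mono) auto
        have p: "r + 1 / r \<ge> 4"
          using r by (intro add_increasing2) auto
        have "1 / (6 * (r + 1 / r)) \<le> 1 / (6 * 4)" "1 / (r + 1 / r)\<^sup>2 \<le> 1 / 4\<^sup>2"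
          using p by (intro divide_left_mono power_mono; simp)+
        then show "0 \<le> 1 - 1 / (6 * (r + 1 / r)) - 1 / (r + 1 / r)\<^sup>2"
          by simp
        show "0 \<le> 2 * (1 - z) / (q + r)"
          using q r u by (intro divide_nonneg_nonneg) auto
      qed
      also have "\<dots> = 2 * (1 - z) * ((1 - 1 / (6 * (r + 1 / r)) - 1 / (r + 1 / r)\<^sup>2) / (2 * r))"
        by simp
      also have "\<dots> \<le> 2 * (1 - z) * ((r / (2 * a) - 1 / (6 * a\<^sup>2)) / r\<^sup>2)"
        using R0[OF r(2)] u unfolding a_def by (rule mult_left_mono)
      also have "\<dots> = (r / (2 * a) - 1 / (6 * a\<^sup>2)) / real k"
        using arg_cong[OF q(4), of "\<lambda>c. (r / (2 * a) - 1 / (6 * a\<^sup>2)) * c"] by simp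
      finally show ?thesis
        using f_eq[OF z, folded r_def] r unfolding q_def[symmetric] by (simp add: max_def)
    qed
    also have "\<dots> \<le> bellman f z"
      unfolding r_def
      by (rule bellman_ge[OF meas bound k z _ _ gain]) (use a ra in \<open>auto simp: r_def\<close>)
    finally show ?thesis unfolding f_def .
  qed
  then show thesis
    by (intro that[of R]) (auto simp: R_def)
qed

section \<open>Comparison of the value with the two solutions, by induction on k\<close>

lemma opt_value_le_upper_sol:
  obtains K where "\<And>k z. z \<in> {0..1} \<Longrightarrow> opt_value k z \<le> K + upper_sol (max 1 (rad k z))"
proof -
  obtain R where R: "R \<ge> 4"
    and step: "\<And>k z K. z \<in> {0..1} \<Longrightarrow> rad k z \<ge> R \<Longrightarrow>
      bellman (\<lambda>x. K + upper_sol (max 1 (min (rad k 0) (rad k x)))) z \<le> K + upper_sol (rad (Suc k) z)"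
    using upper_sol_bellman_step by blast
  \<comment> \<open>The linear bound equals half the squared radius, so this constant covers all
    radii up to R + 1.\<close>
  define K where "K = (R + 1)\<^sup>2 / 2"
  \<comment> \<open>For larger radii monotonicity of \<open>bellman\<close> is combined with the
    step inequality. The latter holds for every additive constant, so \<open>K\<close> does not grow
    with k.\<close>
  have "opt_value k z \<le> K + upper_sol (max 1 (rad k z))" if "z \<in> {0..1}" for k z
    using that
  proof (induction k arbitrary: z)
    case 0
    then show ?case by (simp add: K_def)
  next
    case (Suc k)
    note z = Suc.prems
    show ?case
    proof (cases "rad (Suc k) z \<le> R + 1")
      case True
      have "opt_value (Suc k) z \<le> (rad (Suc k) z)\<^sup>2 / 2"
        unfolding rad_power2[OF z] using opt_value_le_linear[OF z, of "Suc k"] by (simp only: mult.assoc)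
      also have "\<dots> \<le> K"
        unfolding K_def using True z by (intro divide_right_mono power_mono) auto
      also have "\<dots> \<le> K + upper_sol (max 1 (rad (Suc k) z))"
        using upper_sol_nonneg[of "max 1 (rad (Suc k) z)"] by simp
      finally show ?thesis .
    next
      case False
      then have "rad k z \<ge> R"
        using rad_ge_of_rad_Suc[OF z, where k = k and R = "R + 1"] R by simp
      have "opt_value (Suc k) z \<le> bellman (\<lambda>x. K + upper_sol (max 1 (min (rad k 0) (rad k x)))) z"
        unfolding opt_value.simps
      proof (rule bellman_mono[OF _ _ abs_opt_value_le abs_upper_sol_trunc_le _ z])
        show "opt_value k x \<le> K + upper_sol (max 1 (min (rad k 0) (rad k x)))" if "x \<in> {0..1}" for x
          using Suc.IH[OF that] rad_le[OF that, of k] by (simp only: min_absorb2)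
      qed (auto simp: upper_sol_def)
      also have "\<dots> \<le> K + upper_sol (rad (Suc k) z)"
        using \<open>rad k z \<ge> R\<close> by (rule step[OF z])
      also have "rad (Suc k) z = max 1 (rad (Suc k) z)"
        using False R by (intro max_absorb2[symmetric]) linarith
      finally show ?thesis .
    qed
  qed
  then show thesis by (rule that)
qed

lemma opt_value_ge_lower_sol:
  obtains K where "\<And>k z. z \<in> {0..1} \<Longrightarrow> lower_sol (max 2 (rad k z)) - K \<le> opt_value k z"
proof -
  obtain R where R: "R \<ge> 4"
    and step: "\<And>k z K. z \<in> {0..1} \<Longrightarrow> rad k z \<ge> R \<Longrightarrow>
      bellman (\<lambda>x. lower_sol (max 2 (min (rad k 0) (rad k x))) - K) z \<ge> lower_sol (rad (Suc k) z) - K"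
    using lower_sol_bellman_step by blast
  \<comment> \<open>For t between 2 and R + 1 the lower solution is at most t + 1/t, hence at most R
    + 2; after subtracting \<open>K\<close> it lies below the trivial bound 0.\<close>
  define K where "K = R + 2"
  have small: "lower_sol (max 2 (rad k z)) - K \<le> 0" if "rad k z \<le> R + 1" for k z
  proof -
    define t where "t = max 2 (rad k z)"
    have t: "2 \<le> t" "t \<le> R + 1"
      using that R by (auto simp: t_def)
    have "0 \<le> ln t" "1 / t \<le> 1"
      using t by auto
    then show ?thesis
      using t unfolding t_def[symmetric] lower_sol_def K_def by linarith
  qed
  have "lower_sol (max 2 (rad k z)) - K \<le> opt_value k z" if "z \<in> {0..1}" for k z
    using that
  proof (induction k arbitrary: z)
    case 0
    then show ?case using small[of 0 z] R by simp
  next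
    case (Suc k)
    note z = Suc.prems
    show ?case
    proof (cases "rad (Suc k) z \<le> R + 1")
      case True
      then show ?thesis
        using small opt_value_bounds[of "Suc k" z] order_trans by blast
    next
      case False
      then have "rad k z \<ge> R"
        using rad_ge_of_rad_Suc[OF z, where k = k and R = "R + 1"] R by simp
      have "max 2 (rad (Suc k) z) = rad (Suc k) z"
        using False R by (intro max_absorb2) linarith
      then have "lower_sol (max 2 (rad (Suc k) z)) - K = lower_sol (rad (Suc k) z) - K"
        by simp
      also have "\<dots> \<le> bellman (\<lambda>x. lower_sol (max 2 (min (rad k 0) (rad k x))) - K) z"
        using \<open>rad k z \<ge> R\<close> by (rule step[OF z])
      also have "\<dots> \<le> opt_value (Suc k) z"
        unfolding opt_value.simps
      proof (rule bellman_mono[OF _ _ abs_lower_sol_trunc_le abs_opt_value_le _ z])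
        show "lower_sol (max 2 (min (rad k 0) (rad k x))) - K \<le> opt_value k x" if "x \<in> {0..1}" for x
          using Suc.IH[OF that] rad_le[OF that, of k] by (simp only: min_absorb2)
      qed (auto simp: lower_sol_def)
      finally show ?thesis .
    qed
  qed
  then show thesis by (rule that)
qed

lemma opt_value_asymptotics:
  obtains C where "\<And>n. n \<ge> 1 \<Longrightarrow> \<bar>opt_value n 0 - sqrt (2 * real n) + ln (real n) / 12\<bar> \<le> C"
proof -
  obtain K where K: "\<And>k z. z \<in> {0..1} \<Longrightarrow> opt_value k z \<le> K + upper_sol (max 1 (rad k z))"
    using opt_value_le_upper_sol by blast
  obtain L where L: "\<And>k z. z \<in> {0..1} \<Longrightarrow> lower_sol (max 2 (rad k z)) - L \<le> opt_value k z"
    using opt_value_ge_lower_sol by blast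
  \<comment> \<open>The 3 absorbs ln 2 / 12, left over from ln r / 6, and the 2 lost in the lower
    bound when r < 2.\<close>
  have "\<bar>opt_value n 0 - sqrt (2 * real n) + ln (real n) / 12\<bar> \<le> \<bar>K\<bar> + \<bar>L\<bar> + 3" if n: "n \<ge> 1" for n
  proof -
    define r where "r = sqrt (2 * real n)"
    have r: "1 \<le> r" "1 / r \<le> 1" "0 \<le> 1 / r"
      using n by (auto simp: r_def)
    have ln_r: "ln r / 6 = ln 2 / 12 + ln (real n) / 12"
      using n by (simp add: r_def ln_sqrt ln_mult add_divide_distrib)
    have ln2: "0 \<le> ln (2::real)" "ln (2::real) \<le> 1"
      using ln_le_minus_one[of "2::real"] by auto
    have "opt_value n 0 \<le> K + upper_sol r"
      using K[of 0 n] r by (simp add: r_def max_absorb2)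
    moreover have "opt_value n 0 \<ge> r - ln r / 6 - \<bar>L\<bar> - 2"
    proof (cases "r \<ge> 2")
      case True
      then have "r - ln r / 6 + 1 / r - L \<le> opt_value n 0"
        using L[of 0 n] by (simp add: r_def[symmetric] max_absorb2 lower_sol_def)
      then show ?thesis
        using r abs_ge_self[of L] by linarith
    next
      case False
      moreover have "0 \<le> ln r" using r by simp
      ultimately show ?thesis
        using opt_value_bounds[of n 0] by linarith
    qed
    ultimately show ?thesis
      using ln2 r unfolding r_def[symmetric] upper_sol_def ln_r by linarith
  qed
  then show thesis by (rule that)
qed

section \<open>Selection rules and the supermartingale argument\<close>

text \<open>
  A selection rule \<open>s i z \<omega>\<close> decides on item \<open>i\<close> given the last selected value \<open>z\<close>, initially \<open>0\<close>.
\<close>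

primrec last_sel :: "(nat \<Rightarrow> real \<Rightarrow> 'a \<Rightarrow> bool) \<Rightarrow> (nat \<Rightarrow> 'a \<Rightarrow> real) \<Rightarrow> nat \<Rightarrow> 'a \<Rightarrow> real" where
  "last_sel s X 0 = (\<lambda>\<omega>. 0)"
| "last_sel s X (Suc i) = (\<lambda>\<omega>. if s (Suc i) (last_sel s X i \<omega>) \<omega> then X (Suc i) \<omega> else last_sel s X i \<omega>)"

primrec num_sel :: "(nat \<Rightarrow> real \<Rightarrow> 'a \<Rightarrow> bool) \<Rightarrow> (nat \<Rightarrow> 'a \<Rightarrow> real) \<Rightarrow> nat \<Rightarrow> 'a \<Rightarrow> nat" where
  "num_sel s X 0 = (\<lambda>\<omega>. 0)"
| "num_sel s X (Suc i) = (\<lambda>\<omega>. num_sel s X i \<omega> + (if s (Suc i) (last_sel s X i \<omega>) \<omega> then 1 else 0))"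

lemma num_sel_mono: "i \<le> j \<Longrightarrow> num_sel s X i \<omega> \<le> num_sel s X j \<omega>"
  by (rule lift_Suc_mono_le[of "\<lambda>i. num_sel s X i \<omega>"]) auto

lemma num_sel_le: "num_sel s X i \<omega> \<le> i"
  by (induction i) auto

text \<open>The count rises only at selections, so the first time it reaches its current value is
  the time of the latest selection.\<close>

lemma last_sel_eq:
  "num_sel s X i \<omega> \<ge> 1 \<Longrightarrow> last_sel s X i \<omega> = X (LEAST l. num_sel s X i \<omega> \<le> num_sel s X l \<omega>) \<omega>"
proof (induction i)
  case (Suc i)
  show ?case
  proof (cases "s (Suc i) (last_sel s X i \<omega>) \<omega>")
    case True
    have "(LEAST l. num_sel s X (Suc i) \<omega> \<le> num_sel s X l \<omega>) = Suc i"
    proof (rule Least_equality)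
      fix l assume "num_sel s X (Suc i) \<omega> \<le> num_sel s X l \<omega>"
      then show "Suc i \<le> l"
        using True num_sel_mono[of l i s X \<omega>] by (cases "l \<le> i") auto
    qed simp
    with True show ?thesis by simp
  next
    case False
    with Suc show ?thesis by simp
  qed
qed simp

section \<open>Independence of the next item from the past\<close>

locale iid_items = prob_space M for M :: "'a measure" +
  fixes X :: "nat \<Rightarrow> 'a \<Rightarrow> real" and n :: nat
  assumes iid: "iid_uniform_items M X n"
begin

abbreviation filt :: "nat \<Rightarrow> 'a measure" where
  "filt i \<equiv> item_filtration M X n (enat i)"

lemma indep_items: "indep_vars (\<lambda>_. borel) X {1..n}"
  and distr_item: "i \<in> {1..n} \<Longrightarrow> distr M borel (X i) = unif01"
  using iid by (auto simp: iid_uniform_items_def)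

lemma measurable_item: "i \<in> {1..n} \<Longrightarrow> X i \<in> borel_measurable M"
  using indep_items by (auto simp: indep_vars_def)

lemma space_filt: "space (item_filtration M X n t) = space M"
  unfolding item_filtration_def by (intro space_measure_of) auto

lemma sets_filt: "sets (item_filtration M X n t) =
    sigma_sets (space M) {X i -` B \<inter> space M | i B. i \<in> {1..n} \<and> enat i \<le> t \<and> B \<in> sets borel}"
  unfolding item_filtration_def by (intro sets_measure_of) auto

lemma subalgebra_filt: "subalgebra M (item_filtration M X n t)"
  unfolding subalgebra_def space_filt sets_filt
  by (auto intro!: sets.sigma_sets_subset measurable_sets[OF measurable_item])

lemma subalgebra_filt_mono: "t \<le> t' \<Longrightarrow> subalgebra (item_filtration M X n t') (item_filtration M X n t)"
  unfolding subalgebra_def space_filt sets_filt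
  by (auto intro!: sigma_sets_mono' intro: order_trans)

lemmas measurable_filt = measurable_from_subalg[OF subalgebra_filt]
lemmas measurable_filt_mono = measurable_from_subalg[OF subalgebra_filt_mono]

lemma measurable_item_filt:
  assumes "i \<in> {1..n}" "i \<le> j"
  shows "X i \<in> borel_measurable (filt j)"
proof (rule measurableI)
  fix B :: "real set" assume "B \<in> sets borel"
  then show "X i -` B \<inter> space (filt j) \<in> sets (filt j)"
    unfolding space_filt sets_filt using assms by (intro sigma_sets.Basic) auto
qed simp

text \<open>The index blocks \<open>{1..i}\<close> and \<open>{Suc i}\<close> are disjoint, so the
  sigma-algebras they generate are independent; that of \<open>Z\<close> lies in the first.\<close>

lemma indep_var_next_item:
  assumes Z: "Z \<in> borel_measurable (filt i)" and i: "i < n"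
  shows "indep_var borel Z borel (X (Suc i))"
proof -
  let ?E = "\<lambda>i. {X i -` B \<inter> space M | B. B \<in> sets borel}"
  let ?I = "case_bool {1..i} {Suc i}"
  have "indep_sets (\<lambda>b. sigma_sets (space M) (\<Union>l\<in>?I b. ?E l)) UNIV"
  proof (rule indep_sets_collect_sigma)
    have "indep_sets ?E {1..n}"
      using indep_items unfolding indep_vars_def2 by simp
    then show "indep_sets ?E (\<Union>b. ?I b)"
      by (rule indep_sets_mono_index[rotated]) (use i in \<open>auto split: bool.splits\<close>)
    show "disjoint_family_on ?I UNIV"
      by (auto simp: disjoint_family_on_def split: bool.splits)
    show "Int_stable (?E l)" for l
    proof (rule Int_stableI, clarify)
      fix B C :: "real set" assume "B \<in> sets borel" "C \<in> sets borel"
      then show "\<exists>D. X l -` B \<inter> space M \<inter> (X l -` C \<inter> space M) = X l -` D \<inter> space M \<and> D \<in> sets borel"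
        by (intro exI[of _ "B \<inter> C"]) auto
    qed
  qed
  moreover have "(\<Union>l\<in>{1..i}. ?E l) = {X l -` B \<inter> space M | l B. l \<in> {1..n} \<and> enat l \<le> enat i \<and> B \<in> sets borel}"
    using i by (auto; fastforce)
  ultimately have ind: "indep_set (sets (filt i)) (sigma_sets (space M) (?E (Suc i)))"
    unfolding indep_set_def sets_filt
    by (elim arg_cong2[where f = indep_sets, THEN iffD1, rotated -1])
      (auto split: bool.splits simp: fun_eq_iff)
  have "sigma_sets (space M) {Z -` A \<inter> space M | A. A \<in> sets borel} \<subseteq> sets (filt i)"
    using measurable_sets[OF Z] unfolding space_filt
    by (intro sets.sigma_sets_subset[of _ "filt i", unfolded space_filt]) auto
  then have "indep_set (sigma_sets (space M) {Z -` A \<inter> space M | A. A \<in> sets borel}) (sigma_sets (space M) (?E (Suc i)))"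
    using ind unfolding indep_sets2_eq by blast
  then show ?thesis
    unfolding indep_var_eq using measurable_filt[OF Z] measurable_item[of "Suc i"] i by simp
qed

text \<open>By independence the joint law of \<open>Z\<close> and the next item is a product; Fubini
  integrates out the item first, which is \<open>bellman\<close>.\<close>

lemma expectation_choice_value:
  assumes Z: "Z \<in> borel_measurable (filt i)" and i: "i < n"
    and f [measurable]: "f \<in> borel_measurable borel" and B: "\<And>x. \<bar>f x\<bar> \<le> B"
  shows "expectation (\<lambda>\<omega>. choice_value f (Z \<omega>) (X (Suc i) \<omega>)) = expectation (\<lambda>\<omega>. bellman f (Z \<omega>))"
proof -
  have [measurable]: "Z \<in> borel_measurable M" "X (Suc i) \<in> borel_measurable M"
    using measurable_filt[OF Z] measurable_item[of "Suc i"] i by auto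
  interpret D: prob_space "distr M borel Z"
    by (rule prob_space_distr) simp
  interpret P: pair_prob_space "distr M borel Z" unif01 ..
  have m: "(\<lambda>p. choice_value f (fst p) (snd p)) \<in> borel_measurable (borel \<Otimes>\<^sub>M borel)"
    by measurable
  have eq: "distr M (borel \<Otimes>\<^sub>M borel) (\<lambda>\<omega>. (Z \<omega>, X (Suc i) \<omega>)) = distr M borel Z \<Otimes>\<^sub>M unif01"
    using indep_var_next_item[OF Z i] distr_item[of "Suc i"] i
    unfolding indep_var_distribution_eq by simp
  have "expectation (\<lambda>\<omega>. choice_value f (Z \<omega>) (X (Suc i) \<omega>))
      = (\<integral>p. choice_value f (fst p) (snd p) \<partial>(distr M borel Z \<Otimes>\<^sub>M unif01))"
    unfolding eq[symmetric] by (subst integral_distr) (use m in auto)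
  also have "\<dots> = (\<integral>z. (\<integral>x. choice_value f z x \<partial>unif01) \<partial>distr M borel Z)"
  proof (subst P.integral_fst'[symmetric])
    show "integrable (distr M borel Z \<Otimes>\<^sub>M unif01) (\<lambda>p. choice_value f (fst p) (snd p))"
      by (rule P.integrable_const_bound[where B = "B + 1"])
        (use m abs_choice_value_le[of f B, OF B] in \<open>auto cong: measurable_cong_sets sets_pair_measure_cong\<close>)
  qed simp
  also have "\<dots> = expectation (\<lambda>\<omega>. bellman f (Z \<omega>))"
  proof -
    have "(\<lambda>z. \<integral>x. choice_value f z x \<partial>unif01) \<in> borel_measurable borel"
      by (rule unif01.borel_measurable_lebesgue_integral) (simp add: split_beta')
    then show ?thesis
      unfolding bellman_def by (subst integral_distr) auto
  qed
  finally show ?thesis .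
qed

text \<open>Adaptedness is required after substituting any \<open>filt i\<close>-measurable
  \<open>Z\<close> for the last value, which allows the measurability of \<open>last_sel\<close>
  itself to be proved by induction.\<close>

context
  fixes s :: "nat \<Rightarrow> real \<Rightarrow> 'a \<Rightarrow> bool"
  assumes adapted: "\<And>i Z. i < n \<Longrightarrow> Z \<in> borel_measurable (filt i) \<Longrightarrow>
                      Measurable.pred (filt (Suc i)) (\<lambda>\<omega>. s (Suc i) (Z \<omega>) \<omega>)"
begin

lemma measurable_last_sel: "i \<le> n \<Longrightarrow> last_sel s X i \<in> borel_measurable (filt i)"
proof (induction i)
  case (Suc i)
  then have i: "i < n" and Z: "last_sel s X i \<in> borel_measurable (filt i)" by simp_all
  have [measurable]: "X (Suc i) \<in> borel_measurable (filt (Suc i))"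
    using i by (intro measurable_item_filt) auto
  note [measurable] = adapted[OF i Z]
  have [measurable]: "last_sel s X i \<in> borel_measurable (filt (Suc i))"
    using Z by (rule measurable_filt_mono[rotated]) simp
  show ?case
    unfolding last_sel.simps by measurable
qed simp

lemma measurable_num_sel: "i \<le> n \<Longrightarrow> num_sel s X i \<in> measurable (filt i) (count_space UNIV)"
proof (induction i)
  case (Suc i)
  have i: "i < n" "i \<le> n" using Suc.prems by auto
  note [measurable] = adapted[OF i(1) measurable_last_sel[OF i(2)]]
  have [measurable]: "num_sel s X i \<in> measurable (filt (Suc i)) (count_space UNIV)"
    using Suc by (intro measurable_filt_mono[of "enat i" "enat (Suc i)"]) auto
  show ?case
    unfolding num_sel.simps by measurable
qed simp

lemma integrable_num_sel: "i \<le> n \<Longrightarrow> integrable M (\<lambda>\<omega>. real (num_sel s X i \<omega>))"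
  using measurable_filt[OF measurable_num_sel, of i] num_sel_le[of s X i]
  by (intro integrable_const_bound[where B = i]) auto

lemma integrable_opt_value_last_sel: "i \<le> n \<Longrightarrow> integrable M (\<lambda>\<omega>. opt_value k (last_sel s X i \<omega>))"
  using measurable_filt[OF measurable_last_sel, of i] abs_opt_value_le[of k]
  by (intro integrable_const_bound[where B = k]) auto

text \<open>The decision on item \<open>Suc i\<close> does not enter: averaging over the item turns
  the best choice into the value with one more item to come. What a rule really does is compared
  with \<open>choice_value\<close> afterwards.\<close>

lemma expectation_step:
  assumes i: "i < n"
  shows "expectation (\<lambda>\<omega>. num_sel s X i \<omega> + opt_value (n - i) (last_sel s X i \<omega>)) =
         expectation (\<lambda>\<omega>. num_sel s X i \<omega> + choice_value (opt_value (n - Suc i)) (last_sel s X i \<omega>) (X (Suc i) \<omega>))"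
    and "integrable M (\<lambda>\<omega>. num_sel s X i \<omega> + choice_value (opt_value (n - Suc i)) (last_sel s X i \<omega>) (X (Suc i) \<omega>))"
proof -
  let ?f = "opt_value (n - Suc i)"
  have Z: "last_sel s X i \<in> borel_measurable (filt i)"
    using measurable_last_sel i by simp
  have [measurable]: "last_sel s X i \<in> borel_measurable M" "X (Suc i) \<in> borel_measurable M"
    using measurable_filt[OF Z] measurable_item[of "Suc i"] i by auto
  have int: "integrable M (\<lambda>\<omega>. choice_value ?f (last_sel s X i \<omega>) (X (Suc i) \<omega>))"
    by (rule integrable_const_bound[where B = "real (n - Suc i) + 1"])
      (auto intro!: abs_choice_value_le abs_opt_value_le)
  show "integrable M (\<lambda>\<omega>. num_sel s X i \<omega> + choice_value ?f (last_sel s X i \<omega>) (X (Suc i) \<omega>))"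
    using integrable_num_sel[of i] int i by simp
  have "n - i = Suc (n - Suc i)" using i by simp
  then have "opt_value (n - i) = bellman ?f" by simp
  then show "expectation (\<lambda>\<omega>. num_sel s X i \<omega> + opt_value (n - i) (last_sel s X i \<omega>)) =
         expectation (\<lambda>\<omega>. num_sel s X i \<omega> + choice_value ?f (last_sel s X i \<omega>) (X (Suc i) \<omega>))"
    using expectation_choice_value[OF Z i measurable_opt_value abs_opt_value_le, of "n - Suc i"]
      integrable_num_sel[of i] int integrable_opt_value_last_sel[of i "n - i"] i
    by (simp add: Bochner_Integration.integral_add)
qed

text \<open>Supermartingale property: accepting an item above the last value or rejecting it never
  yields more than \<open>choice_value\<close>. At time n the remaining value is 0.\<close>

lemma expectation_num_sel_le:
  assumes incr: "\<And>i. i < n \<Longrightarrow> AE \<omega> in M. s (Suc i) (last_sel s X i \<omega>) \<omega> \<longrightarrow> last_sel s X i \<omega> < X (Suc i) \<omega>"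
  shows "expectation (\<lambda>\<omega>. num_sel s X n \<omega>) \<le> opt_value n 0"
proof -
  have "i \<le> n \<Longrightarrow> expectation (\<lambda>\<omega>. num_sel s X i \<omega> + opt_value (n - i) (last_sel s X i \<omega>)) \<le> opt_value n 0" for i
  proof (induction i)
    case 0
    then show ?case by (simp add: prob_space)
  next
    case (Suc i)
    then have i: "i < n" by simp
    have "expectation (\<lambda>\<omega>. num_sel s X (Suc i) \<omega> + opt_value (n - Suc i) (last_sel s X (Suc i) \<omega>))
      \<le> expectation (\<lambda>\<omega>. num_sel s X i \<omega> + choice_value (opt_value (n - Suc i)) (last_sel s X i \<omega>) (X (Suc i) \<omega>))"
    proof (rule integral_mono_AE[OF _ expectation_step(2)[OF i]])
      show "integrable M (\<lambda>\<omega>. num_sel s X (Suc i) \<omega> + opt_value (n - Suc i) (last_sel s X (Suc i) \<omega>))"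
        using Suc.prems integrable_num_sel integrable_opt_value_last_sel
        by (intro Bochner_Integration.integrable_add) blast+
      show "AE \<omega> in M. num_sel s X (Suc i) \<omega> + opt_value (n - Suc i) (last_sel s X (Suc i) \<omega>)
          \<le> num_sel s X i \<omega> + choice_value (opt_value (n - Suc i)) (last_sel s X i \<omega>) (X (Suc i) \<omega>)"
        using incr[OF i] by eventually_elim (auto simp: choice_value_def)
    qed
    also have "\<dots> \<le> opt_value n 0"
      using Suc expectation_step(1)[OF i] by simp
    finally show ?case .
  qed
  from this[of n] show ?thesis by simp
qed

text \<open>This rule accepts exactly when accepting realises the maximum in
  \<open>choice_value\<close>, so the comparison is a pointwise equality.\<close>

lemma expectation_num_sel_eq:
  assumes opt: "\<And>i z \<omega>. i < n \<Longrightarrow> s (Suc i) z \<omega> \<longleftrightarrow>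
      z < X (Suc i) \<omega> \<and> opt_value (n - Suc i) (X (Suc i) \<omega>) + 1 \<ge> opt_value (n - Suc i) z"
  shows "expectation (\<lambda>\<omega>. num_sel s X n \<omega>) = opt_value n 0"
proof -
  have "i \<le> n \<Longrightarrow> expectation (\<lambda>\<omega>. num_sel s X i \<omega> + opt_value (n - i) (last_sel s X i \<omega>)) = opt_value n 0" for i
  proof (induction i)
    case 0
    then show ?case by (simp add: prob_space)
  next
    case (Suc i)
    then have i: "i < n" by simp
    have "(\<lambda>\<omega>. num_sel s X (Suc i) \<omega> + opt_value (n - Suc i) (last_sel s X (Suc i) \<omega>))
      = (\<lambda>\<omega>. num_sel s X i \<omega> + choice_value (opt_value (n - Suc i)) (last_sel s X i \<omega>) (X (Suc i) \<omega>))"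
      using opt[OF i] by (auto simp: choice_value_def fun_eq_iff max_def)
    then show ?case
      using Suc expectation_step(1)[OF i] by simp
  qed
  from this[of n] show ?thesis by simp
qed

end

end

section \<open>Policies and selection rules\<close>

lemma selection_policyD:
  assumes "selection_policy M X n \<tau>" "\<omega> \<in> space M" "1 \<le> j"
  shows "\<tau> j \<omega> \<in> enat ` {1..n} \<union> {\<infinity>}"
    and "\<tau> j \<omega> < \<tau> (Suc j) \<omega> \<or> (\<tau> j \<omega> = \<infinity> \<and> \<tau> (Suc j) \<omega> = \<infinity>)"
    and "\<tau> (Suc j) \<omega> \<noteq> \<infinity> \<Longrightarrow> X (the_enat (\<tau> j \<omega>)) \<omega> < X (the_enat (\<tau> (Suc j) \<omega>)) \<omega>"
  using assms unfolding selection_policy_def by blast+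

lemma selection_policy_mono:
  assumes "selection_policy M X n \<tau>" "\<omega> \<in> space M" "1 \<le> j" "j \<le> l"
  shows "\<tau> j \<omega> \<le> \<tau> l \<omega>"
  using assms(4)
proof (induction l rule: dec_induct)
  case (step l)
  then have "1 \<le> l" using assms(3) by simp
  from selection_policyD(2)[OF assms(1,2) this] step.IH show ?case by auto
qed simp

text \<open>A policy becomes a rule that ignores the last value and takes item i when i is one of
  its times. The times increase strictly, so each adds one to the count.\<close>

lemma policy_num_sel_ge:
  fixes \<tau> :: "nat \<Rightarrow> 'a \<Rightarrow> enat"
  defines "s \<equiv> \<lambda>i z \<omega>. \<exists>j\<ge>1. \<tau> j \<omega> = enat i"
  assumes pol: "selection_policy M X n \<tau>" and \<omega>: "\<omega> \<in> space M"
  shows "j \<ge> 1 \<Longrightarrow> \<tau> j \<omega> = enat l \<Longrightarrow> j \<le> num_sel s X l \<omega>"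
proof (induction j arbitrary: l rule: nat_induct_at_least)
  case base
  with selection_policyD(1)[OF pol \<omega>, of 1] obtain p where "l = Suc p"
    by (cases l) auto
  moreover have "s l z \<omega>" for z
    using base by (auto simp: s_def)
  ultimately show ?case by simp
next
  case (Suc j)
  have "\<tau> j \<omega> < \<tau> (Suc j) \<omega>"
    using selection_policyD(2)[OF pol \<omega> Suc.hyps(1)] Suc.prems by auto
  with Suc.prems obtain l' where l': "\<tau> j \<omega> = enat l'" "l' < l"
    by (cases "\<tau> j \<omega>") auto
  then obtain p where p: "l = Suc p" "l' \<le> p"
    by (cases l) auto
  have "s l z \<omega>" for z
    using Suc.prems by (auto simp: s_def intro!: exI[of _ "Suc j"])
  then have "num_sel s X l \<omega> = Suc (num_sel s X p \<omega>)"
    using p by simp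
  with Suc.IH[OF l'(1)] num_sel_mono[OF p(2), of s X \<omega>] show ?case by simp
qed

text \<open>The count bounds every index in the set; this also makes the set finite, so that its
  \<open>Max\<close> is meaningful.\<close>

lemma policy_selected_length_le:
  fixes \<tau> :: "nat \<Rightarrow> 'a \<Rightarrow> enat"
  defines "s \<equiv> \<lambda>i z \<omega>. \<exists>j\<ge>1. \<tau> j \<omega> = enat i"
  assumes pol: "selection_policy M X n \<tau>" and \<omega>: "\<omega> \<in> space M"
  shows "selected_length n \<tau> \<omega> \<le> num_sel s X n \<omega>"
proof -
  have "{j. 1 \<le> j \<and> \<tau> j \<omega> \<le> enat n} \<subseteq> {..num_sel s X n \<omega>}"
  proof
    fix j assume "j \<in> {j. 1 \<le> j \<and> \<tau> j \<omega> \<le> enat n}"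
    then have j: "1 \<le> j" "\<tau> j \<omega> \<le> enat n" by auto
    then obtain l where l: "\<tau> j \<omega> = enat l" "l \<le> n"
      by (cases "\<tau> j \<omega>") auto
    then show "j \<in> {..num_sel s X n \<omega>}"
      using policy_num_sel_ge[OF pol \<omega> j(1) l(1)] num_sel_mono[OF l(2), of s X \<omega>]
      by (simp add: s_def)
  qed
  then show ?thesis
    unfolding selected_length_def
    by (subst Max_le_iff) (auto intro: finite_subset)
qed

text \<open>The last value is the item at the preceding time of the policy, or 0 if there is none.
  In the latter case the policy imposes no inequality, and positivity of the item takes its
  place.\<close>

lemma policy_last_sel_less:
  fixes \<tau> :: "nat \<Rightarrow> 'a \<Rightarrow> enat"
  defines "s \<equiv> \<lambda>i z \<omega>. \<exists>j\<ge>1. \<tau> j \<omega> = enat i"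
  assumes pol: "selection_policy M X n \<tau>" and \<omega>: "\<omega> \<in> space M"
    and sel: "s (Suc i) z \<omega>" and pos: "0 < X (Suc i) \<omega>"
  shows "last_sel s X i \<omega> < X (Suc i) \<omega>"
proof -
  obtain j where j: "j \<ge> 1" "\<tau> j \<omega> = enat (Suc i)"
    using sel by (auto simp: s_def)
  note mono = selection_policy_mono[OF pol \<omega>]
  show ?thesis
  proof (cases "j = 1")
    case True
    have none: "\<not> s l z \<omega>" if "l \<le> i" for l z
    proof
      assume "s l z \<omega>"
      then obtain m where "m \<ge> 1" "\<tau> m \<omega> = enat l"
        by (auto simp: s_def)
      with mono[of 1 m] j that True show False by simp
    qed
    have "l \<le> i \<Longrightarrow> last_sel s X l \<omega> = 0" for l
      by (induction l) (auto simp: none)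
    then show ?thesis using pos by simp
  next
    case False
    then obtain j' where j': "j = Suc j'" "j' \<ge> 1"
      using j(1) by (cases j) auto
    have *: "\<tau> j' \<omega> < \<tau> j \<omega>" "X (the_enat (\<tau> j' \<omega>)) \<omega> < X (the_enat (\<tau> j \<omega>)) \<omega>"
      using selection_policyD(2,3)[OF pol \<omega> j'(2)] j j' by auto
    then obtain p where p: "\<tau> j' \<omega> = enat p" "p \<le> i"
      using j by (cases "\<tau> j' \<omega>") auto
    \<comment> \<open>By monotonicity no time of the policy lies strictly between two consecutive
      ones, so the last value stays frozen from p to i.\<close>
    have none: "\<not> s l z \<omega>" if l: "p < l" "l \<le> i" for l z
    proof
      assume "s l z \<omega>"
      then obtain m where m: "m \<ge> 1" "\<tau> m \<omega> = enat l"
        by (auto simp: s_def)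
      show False
      proof (cases "m \<le> j'")
        case True
        with mono[of m j'] m p l show False by simp
      next
        case False
        with mono[of j m] m j j' l show False by simp
      qed
    qed
    obtain q where q: "p = Suc q"
      using selection_policyD(1)[OF pol \<omega> j'(2)] p(1) by (cases p) auto
    have "s p z \<omega>" for z
      using p j'(2) by (auto simp: s_def)
    then have base: "last_sel s X p \<omega> = X p \<omega>"
      by (simp add: q)
    have "last_sel s X l \<omega> = X p \<omega>" if "p \<le> l" "l \<le> i" for l
      using that
    proof (induction l rule: dec_induct)
      case (step l)
      then show ?case by (simp add: none)
    qed (rule base)
    then show ?thesis
      using * p j by simp
  qed
qed

lemma (in iid_items) expectation_selected_length_le:
  assumes pol: "selection_policy M X n \<tau>"
  shows "expectation (\<lambda>\<omega>. selected_length n \<tau> \<omega>) \<le> opt_value n 0"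
proof -
  define s :: "nat \<Rightarrow> real \<Rightarrow> 'a \<Rightarrow> bool" where "s = (\<lambda>i z \<omega>. \<exists>j\<ge>1. \<tau> j \<omega> = enat i)"
  have st: "Measurable.pred (item_filtration M X n t) (\<lambda>\<omega>. \<tau> j \<omega> \<le> t)" if "j \<ge> 1" for j t
    using pol that unfolding selection_policy_def by (auto intro: stopping_timeD)
  have adapted: "Measurable.pred (filt (Suc i)) (\<lambda>\<omega>. s (Suc i) (Z \<omega>) \<omega>)" for i Z
  proof -
    have "Measurable.pred (filt (Suc i)) (\<lambda>\<omega>. \<tau> j \<omega> \<le> enat i)"
      "Measurable.pred (filt (Suc i)) (\<lambda>\<omega>. \<tau> j \<omega> \<le> enat (Suc i))" if "j \<ge> 1" for j
      using st[OF that] by (auto intro: measurable_filt_mono[of "enat i" "enat (Suc i)"])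
    then have "Measurable.pred (filt (Suc i)) (\<lambda>\<omega>. j \<ge> 1 \<and> \<not> \<tau> j \<omega> \<le> enat i \<and> \<tau> j \<omega> \<le> enat (Suc i))" for j
      by (cases "j \<ge> 1") auto
    then have *: "Measurable.pred (filt (Suc i)) (\<lambda>\<omega>. \<exists>j. j \<ge> 1 \<and> \<not> \<tau> j \<omega> \<le> enat i \<and> \<tau> j \<omega> \<le> enat (Suc i))"
      by measurable
    \<comment> \<open>Stopping times give measurability of events \<open>\<tau> j \<le> t\<close>
      only, so equality with \<open>Suc i\<close> is written as a difference of two of them.\<close>
    have eq: "t = enat (Suc i) \<longleftrightarrow> \<not> t \<le> enat i \<and> t \<le> enat (Suc i)" for t
      by (cases t) auto
    show ?thesis
      unfolding s_def eq by (rule *)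
  qed
  have "expectation (\<lambda>\<omega>. num_sel s X n \<omega>) \<le> opt_value n 0"
  proof (rule expectation_num_sel_le[OF adapted])
    fix i assume i: "i < n"
    have "AE x in distr M borel (X (Suc i)). 0 < x"
      unfolding distr_item[of "Suc i", simplified, OF Suc_leI[OF i]]
      using AE_unif01 by eventually_elim simp
    then have "AE \<omega> in M. 0 < X (Suc i) \<omega>"
      using measurable_item[of "Suc i"] i by (subst (asm) AE_distr_iff) auto
    with AE_space show "AE \<omega> in M. s (Suc i) (last_sel s X i \<omega>) \<omega> \<longrightarrow> last_sel s X i \<omega> < X (Suc i) \<omega>"
    proof eventually_elim
      case (elim \<omega>)
      then show ?case
        unfolding s_def using policy_last_sel_less[OF pol] by blast
    qed
  qed
  \<comment> \<open>Domination by a nonnegative integrable function suffices, since the integral of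
    a non-integrable function is 0 by convention.\<close>
  moreover have "expectation (\<lambda>\<omega>. selected_length n \<tau> \<omega>) \<le> expectation (\<lambda>\<omega>. num_sel s X n \<omega>)"
    using integrable_num_sel[of s n, OF adapted] policy_selected_length_le[OF pol]
    by (intro integral_mono') (auto simp: s_def)
  ultimately show ?thesis by simp
qed

section \<open>Attainment: selection rules turned into policies\<close>

definition rule_time ::
    "(nat \<Rightarrow> real \<Rightarrow> 'a \<Rightarrow> bool) \<Rightarrow> (nat \<Rightarrow> 'a \<Rightarrow> real) \<Rightarrow> nat \<Rightarrow> nat \<Rightarrow> 'a \<Rightarrow> enat" where
  "rule_time s X n j \<omega> =
     (if j \<le> num_sel s X n \<omega> then enat (LEAST i. j \<le> num_sel s X i \<omega>) else \<infinity>)"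

text \<open>Turns the stopping property into measurability of the count. The minimum with n appears
  because a rule may go on selecting after n, where the policy has stopped.\<close>

lemma rule_time_le_iff: "rule_time s X n j \<omega> \<le> enat i \<longleftrightarrow> j \<le> num_sel s X (min i n) \<omega>"
proof
  assume "rule_time s X n j \<omega> \<le> enat i"
  then have j: "j \<le> num_sel s X n \<omega>" and le: "(LEAST i. j \<le> num_sel s X i \<omega>) \<le> i"
    by (auto simp: rule_time_def split: if_splits)
  have "j \<le> num_sel s X (LEAST i. j \<le> num_sel s X i \<omega>) \<omega>"
    using j by (rule LeastI)
  also have "\<dots> \<le> num_sel s X i \<omega>"
    using le by (rule num_sel_mono)
  finally show "j \<le> num_sel s X (min i n) \<omega>"
    using j by (simp add: min_def)
next
  assume *: "j \<le> num_sel s X (min i n) \<omega>"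
  then have "j \<le> num_sel s X n \<omega>"
    by (rule order_trans) (simp add: num_sel_mono)
  moreover have "(LEAST i. j \<le> num_sel s X i \<omega>) \<le> min i n"
    using * by (rule Least_le)
  ultimately show "rule_time s X n j \<omega> \<le> enat i"
    by (simp add: rule_time_def)
qed

lemma (in iid_items) selection_policy_of_rule:
  fixes s :: "nat \<Rightarrow> real \<Rightarrow> 'a \<Rightarrow> bool"
  defines "\<tau> \<equiv> rule_time s X n"
  assumes adapted: "\<And>i Z. i < n \<Longrightarrow> Z \<in> borel_measurable (filt i) \<Longrightarrow>
                      Measurable.pred (filt (Suc i)) (\<lambda>\<omega>. s (Suc i) (Z \<omega>) \<omega>)"
    and incr: "\<And>i z \<omega>. s (Suc i) z \<omega> \<Longrightarrow> z < X (Suc i) \<omega>"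
  shows "selection_policy M X n \<tau>" "selected_length n \<tau> \<omega> = num_sel s X n \<omega>"
proof -
  have le_iff: "\<tau> j \<omega> \<le> enat i \<longleftrightarrow> j \<le> num_sel s X (min i n) \<omega>" for i j \<omega>
    unfolding \<tau>_def by (rule rule_time_le_iff)
  \<comment> \<open>A finite j-th time is a jump of the count from j - 1 to j; it is a successor
    because the count starts at 0.\<close>
  have finite_time: "\<exists>p. \<tau> j \<omega> = enat (Suc p) \<and> Suc p \<le> n \<and> s (Suc p) (last_sel s X p \<omega>) \<omega> \<and> num_sel s X p \<omega> = j - 1"
    if j: "j \<ge> 1" "\<tau> j \<omega> \<noteq> \<infinity>" for j \<omega>
  proof -
    let ?l = "LEAST i. j \<le> num_sel s X i \<omega>"
    have jn: "j \<le> num_sel s X n \<omega>" and l: "\<tau> j \<omega> = enat ?l"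
      using j by (auto simp: \<tau>_def rule_time_def split: if_splits)
    have jl: "j \<le> num_sel s X ?l \<omega>"
      using jn by (rule LeastI)
    with j obtain p where p: "?l = Suc p"
      by (cases ?l) auto
    have "\<not> j \<le> num_sel s X p \<omega>"
      by (rule not_less_Least) (simp add: p)
    with jl have "s (Suc p) (last_sel s X p \<omega>) \<omega>" "num_sel s X p \<omega> = j - 1"
      unfolding p by (auto split: if_splits)
    moreover have "?l \<le> n"
      using jn by (rule Least_le)
    ultimately show ?thesis
      using l p by auto
  qed
  have next_time: "\<exists>l. \<tau> j \<omega> = enat l \<and> enat l < \<tau> (Suc j) \<omega> \<and> X l \<omega> < X (the_enat (\<tau> (Suc j) \<omega>)) \<omega>"
    if j: "j \<ge> 1" "\<tau> (Suc j) \<omega> \<noteq> \<infinity>" for j \<omega>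
  proof -
    obtain p where p: "\<tau> (Suc j) \<omega> = enat (Suc p)" "Suc p \<le> n"
      "s (Suc p) (last_sel s X p \<omega>) \<omega>" "num_sel s X p \<omega> = j"
      using finite_time[of "Suc j" \<omega>] j by auto
    have "\<tau> j \<omega> \<le> enat p"
      using p by (simp add: le_iff)
    \<comment> \<open>The count at p is j, so the j-th time is that of the latest selection up to p,
      and \<open>last_sel_eq\<close> identifies the item there.\<close>
    moreover have "\<tau> j \<omega> = enat (LEAST l. num_sel s X p \<omega> \<le> num_sel s X l \<omega>)"
      using p(2,4) num_sel_mono[of p n s X \<omega>] by (simp add: \<tau>_def rule_time_def)
    moreover have "last_sel s X p \<omega> < X (Suc p) \<omega>"
      using p(3) by (rule incr)
    ultimately show ?thesis
      using last_sel_eq[of s X p \<omega>] p j(1) by auto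
  qed
  show "selection_policy M X n \<tau>"
    unfolding selection_policy_def
  proof (intro conjI allI impI ballI)
    fix j :: nat assume j: "1 \<le> j"
    show "stopping_time (item_filtration M X n) (\<tau> j)"
      unfolding stopping_time_def
    proof
      fix t
      show "Measurable.pred (item_filtration M X n t) (\<lambda>\<omega>. \<tau> j \<omega> \<le> t)"
      proof (cases t)
        case (enat i)
        have [measurable]: "num_sel s X (min i n) \<in> measurable (filt i) (count_space UNIV)"
        proof (rule measurable_filt_mono)
          show "num_sel s X (min i n) \<in> measurable (filt (min i n)) (count_space UNIV)"
            by (rule measurable_num_sel, erule (1) adapted) simp
        qed simp
        show ?thesis
          unfolding enat le_iff by measurable
      qed simp
    qed
  next
    fix j :: nat and \<omega> assume j: "1 \<le> j"
    show "\<tau> j \<omega> \<in> enat ` {1..n} \<union> {\<infinity>}"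
    proof (cases "\<tau> j \<omega> = \<infinity>")
      case False
      then show ?thesis using finite_time[OF j False] by auto
    qed simp
    show "\<tau> j \<omega> < \<tau> (Suc j) \<omega> \<or> \<tau> j \<omega> = \<infinity> \<and> \<tau> (Suc j) \<omega> = \<infinity>"
      using next_time[OF j, of \<omega>] by (cases "\<tau> (Suc j) \<omega> = \<infinity>"; cases "\<tau> j \<omega>") auto
    show "X (the_enat (\<tau> j \<omega>)) \<omega> < X (the_enat (\<tau> (Suc j) \<omega>)) \<omega>" if "\<tau> (Suc j) \<omega> \<noteq> \<infinity>"
      using next_time[OF j that] by auto
  qed
  have eq: "insert 0 {j. 1 \<le> j \<and> \<tau> j \<omega> \<le> enat n} = {0..num_sel s X n \<omega>}"
    by (auto simp: le_iff)
  show "selected_length n \<tau> \<omega> = num_sel s X n \<omega>"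
    unfolding selected_length_def eq by (rule Max_eqI) auto
qed

lemma (in iid_items) max_expected_length_eq: "max_expected_length M X n = opt_value n 0"
proof -
  \<comment> \<open>The greedy rule: after item i there remain n - i items, and ties are resolved by
    accepting.\<close>
  define s where "s = (\<lambda>i z \<omega>. z < X i \<omega> \<and> opt_value (n - i) (X i \<omega>) + 1 \<ge> opt_value (n - i) z)"
  have adapted: "Measurable.pred (filt (Suc i)) (\<lambda>\<omega>. s (Suc i) (Z \<omega>) \<omega>)"
    if "i < n" and Z: "Z \<in> borel_measurable (filt i)" for i Z
  proof -
    have [measurable]: "X (Suc i) \<in> borel_measurable (filt (Suc i))"
      using that by (intro measurable_item_filt) auto
    have [measurable]: "Z \<in> borel_measurable (filt (Suc i))"
      using Z by (rule measurable_filt_mono[rotated]) simp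
    show ?thesis unfolding s_def by measurable
  qed
  define \<tau> where "\<tau> = rule_time s X n"
  have incr: "\<And>i z \<omega>. s (Suc i) z \<omega> \<Longrightarrow> z < X (Suc i) \<omega>"
    by (simp add: s_def)
  have pol: "selection_policy M X n \<tau>" "selected_length n \<tau> \<omega> = num_sel s X n \<omega>" for \<omega>
    unfolding \<tau>_def by (rule selection_policy_of_rule, erule (1) adapted, erule incr)+
  have "expectation (\<lambda>\<omega>. selected_length n \<tau> \<omega>) = opt_value n 0"
    unfolding pol(2) by (rule expectation_num_sel_eq, erule (1) adapted, simp add: s_def)
  then show ?thesis
    unfolding max_expected_length_def
    using pol(1) expectation_selected_length_le
    by (intro cSup_eq_maximum) (auto intro!: image_eqI[of _ _ \<tau>])
qed

theorem theorem3p2: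
  fixes M :: "nat \<Rightarrow> 'a measure"
    and X :: "nat \<Rightarrow> nat \<Rightarrow> 'a \<Rightarrow> real"
  assumes "\<And>n. n \<ge> 1 \<Longrightarrow> iid_uniform_items (M n) (X n) n"
  shows "bdd_above ((\<lambda>n. \<bar>max_expected_length (M n) (X n) n - sqrt (2 * real n) + ln (real n) / 12\<bar>) ` {1..})"
proof -
  obtain C where C: "\<And>n. n \<ge> 1 \<Longrightarrow> \<bar>opt_value n 0 - sqrt (2 * real n) + ln (real n) / 12\<bar> \<le> C"
    using opt_value_asymptotics by blast
  \<comment> \<open>The probability space may change with n; the value depends on n alone.\<close>
  have "max_expected_length (M n) (X n) n = opt_value n 0" if "n \<ge> 1" for n
  proof -
    interpret prob_space "M n"
      using assms[OF that] by (simp add: iid_uniform_items_def)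
    interpret iid_items "M n" "X n" n
      by standard (rule assms[OF that])
    show ?thesis by (rule max_expected_length_eq)
  qed
  with C show ?thesis
    by (intro bdd_aboveI[of _ C]) auto
qed

end
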